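(* Let $X$ be a stratifiable $k$-space. Then the following are equivalent: (1) $F_{8}(X)$ has countable tightness; (2) $F(X)$ has countable tightness; (3) $X$ is separable or discrete. *)

theory Defs
  imports "HOL-Analysis.Analysis"
begin

definition stratification :: "'a topology \<Rightarrow> ('a set \<Rightarrow> nat \<Rightarrow> 'a set) \<Rightarrow> bool" where
  "stratification X S \<longleftrightarrow>
     (\<forall>U n. openin X U \<longrightarrow> openin X (S U n) \<and> X closure_of (S U n) \<subseteq> U) \<and>
     (\<forall>U. openin X U \<longrightarrow> (\<Union>n. S U n) = U) \<and>
     (\<forall>U V n. openin X U \<and> openin X V \<and> U \<subseteq> V \<longrightarrow> S U n \<subseteq> S V n)"

definition stratifiable_space :: "'a topology \<Rightarrow> bool" where
  "stratifiable_space X \<longleftrightarrow> t1_space X \<and> (\<exists>S. stratification X S)"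

definition countable_tightness :: "'a topology \<Rightarrow> bool" where
  "countable_tightness X \<longleftrightarrow>
     (\<forall>A x. A \<subseteq> topspace X \<and> x \<in> X closure_of A \<longrightarrow>
        (\<exists>B. B \<subseteq> A \<and> countable B \<and> x \<in> X closure_of B))"

text \<open>A letter is a pair (x, b): (x, True) stands for x and (x, False) for x^{-1}.\<close>

definition reduced_word :: "('a \<times> bool) list \<Rightarrow> bool" where
  "reduced_word w \<longleftrightarrow> (\<forall>i. Suc i < length w \<longrightarrow>
      \<not> (fst (w ! i) = fst (w ! Suc i) \<and> snd (w ! i) \<noteq> snd (w ! Suc i)))"

definition free_words :: "'a set \<Rightarrow> ('a \<times> bool) list set" where
  "free_words A = {w. reduced_word w \<and> fst ` set w \<subseteq> A}"

definition cons_red :: "'a \<times> bool \<Rightarrow> ('a \<times> bool) list \<Rightarrow> ('a \<times> bool) list" where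
  "cons_red l w = (case w of [] \<Rightarrow> [l]
       | h # t \<Rightarrow> (if fst h = fst l \<and> snd h \<noteq> snd l then t else l # w))"

definition word_mult :: "('a \<times> bool) list \<Rightarrow> ('a \<times> bool) list \<Rightarrow> ('a \<times> bool) list" where
  "word_mult u v = foldr cons_red u v"

definition word_inv :: "('a \<times> bool) list \<Rightarrow> ('a \<times> bool) list" where
  "word_inv u = rev (map (\<lambda>(x, b). (x, \<not> b)) u)"

definition word_of :: "'a \<Rightarrow> ('a \<times> bool) list" where
  "word_of x = [(x, True)]"

definition free_group_topology :: "'a topology \<Rightarrow> ('a \<times> bool) list topology \<Rightarrow> bool" where
  "free_group_topology X T \<longleftrightarrow>
     topspace T = free_words (topspace X) \<and>
     continuous_map (prod_topology T T) T (\<lambda>(u, v). word_mult u v) \<and>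
     continuous_map T T word_inv"

text \<open>F(X): the finest group topology on the free group over X for which the
  canonical map X \<rightarrow> F(X) is continuous (the supremum of all such topologies).\<close>
definition FTG :: "'a topology \<Rightarrow> ('a \<times> bool) list topology" where
  "FTG X = topology_generated_by
     (\<Union>{Collect (openin T) | T. free_group_topology X T \<and> continuous_map X T word_of})"

definition FTG_n :: "nat \<Rightarrow> 'a topology \<Rightarrow> ('a \<times> bool) list topology" where
  "FTG_n n X = subtopology (FTG X) {w \<in> free_words (topspace X). length w \<le> n}"

end

(* Every subset A of a space has a dense left-separated subset B: each point of B has a neighbourhood
   free of points of A that precede it in a fixed well-order. In F(X) such neighbourhoods contain boxes of
   words, and stratifiability shrinks boxes belonging to a fixed signature to pairwise disjoint ones;
   so if X is separable, B is countable and F(X) is countably tight.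

   If X is not separable, the same argument in X gives an uncountable discrete family of open sets G(d)
   containing d. If X is moreover a non-discrete k-space, points being G-delta in compact sets yields a
   nontrivial sequence x(n) converging to x. Arrange the d in type omega_1 with injections f(a) of the
   predecessors of a into the naturals. The words b x(n) x^-1 b^-1 a x(n) x^-1 a^-1 with b < a and
   n = f(a)(b) have length at most 8 and accumulate at the identity, but no countable set of them does:
   a homomorphism into a Heisenberg group with a box topology maps this word to the central
   element r(x(n)) (e_a + e_b), and the box can be chosen to avoid countably many of these. *)

theory Submission
  imports Defs
begin

section \<open>Reduced words\<close>

lemma reduced_word_Nil [simp]: "reduced_word []"
  and reduced_word_single [simp]: "reduced_word [l]"
  by (simp_all add: reduced_word_def)

lemma reduced_word_Cons_Cons [simp]:
  "reduced_word (l # h # t) \<longleftrightarrow> \<not> (fst h = fst l \<and> snd h \<noteq> snd l) \<and> reduced_word (h # t)"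
proof
  assume R: "reduced_word (l # h # t)"
  then have 1: "\<not> (fst ((l # h # t) ! i) = fst ((l # h # t) ! Suc i) \<and> snd ((l # h # t) ! i) \<noteq> snd ((l # h # t) ! Suc i))"
    if "Suc i < length (l # h # t)" for i
    using that unfolding reduced_word_def by blast
  show "\<not> (fst h = fst l \<and> snd h \<noteq> snd l) \<and> reduced_word (h # t)"
    using 1[of 0] 1[of "Suc _"] by (auto simp: reduced_word_def)
next
  assume R: "\<not> (fst h = fst l \<and> snd h \<noteq> snd l) \<and> reduced_word (h # t)"
  show "reduced_word (l # h # t)"
    unfolding reduced_word_def
  proof (intro allI impI)
    fix i assume "Suc i < length (l # h # t)"
    then show "\<not> (fst ((l # h # t) ! i) = fst ((l # h # t) ! Suc i) \<and> snd ((l # h # t) ! i) \<noteq> snd ((l # h # t) ! Suc i))"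
      using R by (cases i) (auto simp: reduced_word_def)
  qed
qed

lemma reduced_word_tl: "reduced_word (l # w) \<Longrightarrow> reduced_word w"
  by (cases w) auto

lemma cons_red_eq_Cons: "reduced_word (l # w) \<Longrightarrow> cons_red l w = l # w"
  by (cases w) (auto simp: cons_red_def)

lemma reduced_word_cons_red: "reduced_word w \<Longrightarrow> reduced_word (cons_red l w)"
  by (cases w) (auto simp: cons_red_def dest: reduced_word_tl)

lemma set_cons_red: "set (cons_red l w) \<subseteq> insert l (set w)"
  by (cases w) (auto simp: cons_red_def)

lemma length_cons_red: "length (cons_red l w) \<le> Suc (length w)"
  by (cases w) (auto simp: cons_red_def)

lemma Nil_in_free_words [simp]: "[] \<in> free_words A"
  by (simp add: free_words_def)

lemma single_in_free_words [simp]: "[l] \<in> free_words A \<longleftrightarrow> fst l \<in> A"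
  by (simp add: free_words_def)

lemma cons_red_in_free_words: "fst l \<in> A \<Longrightarrow> w \<in> free_words A \<Longrightarrow> cons_red l w \<in> free_words A"
  using set_cons_red[of l w] reduced_word_cons_red[of w l] unfolding free_words_def by auto

lemma free_words_ConsD: "l # w \<in> free_words A \<Longrightarrow> fst l \<in> A \<and> w \<in> free_words A"
  by (auto simp: free_words_def dest: reduced_word_tl)

lemma word_mult_Nil [simp]: "word_mult [] v = v"
  and word_mult_Cons [simp]: "word_mult (l # u) v = cons_red l (word_mult u v)"
  by (simp_all add: word_mult_def)

lemma word_mult_in_free_words:
  "u \<in> free_words A \<Longrightarrow> v \<in> free_words A \<Longrightarrow> word_mult u v \<in> free_words A"
  by (induction u) (auto dest!: free_words_ConsD intro: cons_red_in_free_words)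

lemma length_word_mult: "length (word_mult u v) \<le> length u + length v"
  by (induction u) (auto intro: order_trans[OF length_cons_red])

lemma word_inv_Nil [simp]: "word_inv [] = []"
  and word_inv_Cons [simp]: "word_inv (l # u) = word_inv u @ [(fst l, \<not> snd l)]"
  by (simp_all add: word_inv_def split_beta)

text \<open>Stated with \<open>successively\<close> because that predicate behaves well under
  \<open>rev\<close> and \<open>map\<close>, the two operations that make up
  \<open>word_inv\<close>.\<close>

lemma reduced_word_iff_successively:
  "reduced_word w \<longleftrightarrow> successively (\<lambda>l h. \<not> (fst h = fst l \<and> snd h \<noteq> snd l)) w"
  by (induction w rule: induct_list012) auto

lemma word_inv_in_free_words: "u \<in> free_words A \<Longrightarrow> word_inv u \<in> free_words A"
  by (auto simp: free_words_def word_inv_def reduced_word_iff_successively successively_map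
      split_beta elim!: successively_mono)

section \<open>The free topological group\<close>

text \<open>The topology on \<open>A\<close> induced by \<open>\<Phi>\<close> from the box topology
  on real families: every coordinate carries its own radius \<open>e i\<close>, with no common
  positive lower bound. Since only values of \<open>\<Phi>\<close> are compared,
  \<open>\<Phi>\<close> may fail to be injective.\<close>

definition box_topology :: "'w set \<Rightarrow> ('w \<Rightarrow> 'i \<Rightarrow> real) \<Rightarrow> 'w topology" where
  "box_topology A \<Phi> = topology (\<lambda>W. W \<subseteq> A \<and> (\<forall>w\<in>W. \<exists>e. (\<forall>i. e i > 0) \<and>
     (\<forall>v\<in>A. (\<forall>i. \<bar>\<Phi> v i - \<Phi> w i\<bar> < e i) \<longrightarrow> v \<in> W)))"

lemma openin_box_topology:
  "openin (box_topology A \<Phi>) W \<longleftrightarrow> W \<subseteq> A \<and> (\<forall>w\<in>W. \<exists>e. (\<forall>i. e i > 0) \<and>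
     (\<forall>v\<in>A. (\<forall>i. \<bar>\<Phi> v i - \<Phi> w i\<bar> < e i) \<longrightarrow> v \<in> W))"
proof -
  let ?P = "\<lambda>W. W \<subseteq> A \<and> (\<forall>w\<in>W. \<exists>e. (\<forall>i. e i > 0) \<and>
     (\<forall>v\<in>A. (\<forall>i. \<bar>\<Phi> v i - \<Phi> w i\<bar> < e i) \<longrightarrow> v \<in> W))"
  have "istopology ?P"
    unfolding istopology_def
  proof (intro conjI allI impI)
    fix S T assume S: "?P S" and T: "?P T"
    show "S \<inter> T \<subseteq> A" using S by auto
    show "\<forall>w\<in>S \<inter> T. \<exists>e. (\<forall>i. e i > 0) \<and> (\<forall>v\<in>A. (\<forall>i. \<bar>\<Phi> v i - \<Phi> w i\<bar> < e i) \<longrightarrow> v \<in> S \<inter> T)"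
    proof
      fix w assume w: "w \<in> S \<inter> T"
      from S w obtain e where e: "\<forall>i. e i > 0" "\<forall>v\<in>A. (\<forall>i. \<bar>\<Phi> v i - \<Phi> w i\<bar> < e i) \<longrightarrow> v \<in> S"
        by blast
      from T w obtain f where f: "\<forall>i. f i > 0" "\<forall>v\<in>A. (\<forall>i. \<bar>\<Phi> v i - \<Phi> w i\<bar> < f i) \<longrightarrow> v \<in> T"
        by blast
      show "\<exists>e. (\<forall>i. e i > 0) \<and> (\<forall>v\<in>A. (\<forall>i. \<bar>\<Phi> v i - \<Phi> w i\<bar> < e i) \<longrightarrow> v \<in> S \<inter> T)"
        using e f by (intro exI[of _ "\<lambda>i. min (e i) (f i)"]) auto
    qed
  next
    fix \<K> assume K: "\<forall>K\<in>\<K>. ?P K"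
    then show "\<Union>\<K> \<subseteq> A" by auto
    show "\<forall>w\<in>\<Union>\<K>. \<exists>e. (\<forall>i. e i > 0) \<and> (\<forall>v\<in>A. (\<forall>i. \<bar>\<Phi> v i - \<Phi> w i\<bar> < e i) \<longrightarrow> v \<in> \<Union>\<K>)"
      using K by (metis UnionE UnionI)
  qed
  then show ?thesis
    unfolding box_topology_def by (simp add: topology_inverse')
qed

lemma topspace_box_topology [simp]: "topspace (box_topology A \<Phi>) = A"
proof -
  have "openin (box_topology A \<Phi>) A"
    unfolding openin_box_topology by (auto intro: exI[of _ "\<lambda>_. 1"])
  moreover have "topspace (box_topology A \<Phi>) \<subseteq> A"
    using openin_topspace[of "box_topology A \<Phi>"] unfolding openin_box_topology by blast
  ultimately show ?thesis
    by (simp add: openin_subset subset_antisym)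
qed

text \<open>At a point \<open>w\<close> of the box each coordinate keeps the slack
  \<open>e i - \<bar>\<Phi> w i - c i\<bar>\<close>. These slacks form an admissible family of
  radii, however small they get.\<close>

lemma openin_box_topology_box:
  assumes "\<And>i. e i > (0::real)"
  shows "openin (box_topology A \<Phi>) {v\<in>A. \<forall>i. \<bar>\<Phi> v i - c i\<bar> < e i}"
  unfolding openin_box_topology
proof (intro conjI ballI)
  fix w assume w: "w \<in> {v\<in>A. \<forall>i. \<bar>\<Phi> v i - c i\<bar> < e i}"
  have "\<bar>\<Phi> v i - c i\<bar> < e i" if "\<bar>\<Phi> v i - \<Phi> w i\<bar> < e i - \<bar>\<Phi> w i - c i\<bar>" for v i
    using that by linarith
  then show "\<exists>e'. (\<forall>i. 0 < e' i) \<and> (\<forall>v\<in>A. (\<forall>i. \<bar>\<Phi> v i - \<Phi> w i\<bar> < e' i) \<longrightarrow>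
      v \<in> {v\<in>A. \<forall>i. \<bar>\<Phi> v i - c i\<bar> < e i})"
    using w by (intro exI[of _ "\<lambda>i. e i - \<bar>\<Phi> w i - c i\<bar>"]) auto
qed auto

lemma continuous_map_box_topology:
  assumes "\<And>y. y \<in> topspace Y \<Longrightarrow> f y \<in> A"
    and "\<And>y e. y \<in> topspace Y \<Longrightarrow> (\<And>i. e i > 0) \<Longrightarrow>
      \<exists>N. openin Y N \<and> y \<in> N \<and> (\<forall>y'\<in>N. \<forall>i. \<bar>\<Phi> (f y') i - \<Phi> (f y) i\<bar> < e i)"
  shows "continuous_map Y (box_topology A \<Phi>) f"
  unfolding continuous_map_def
proof (intro conjI allI impI)
  fix W assume W: "openin (box_topology A \<Phi>) W"
  show "openin Y {y \<in> topspace Y. f y \<in> W}"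
  proof (subst openin_subopen, intro ballI)
    fix y assume y: "y \<in> {y \<in> topspace Y. f y \<in> W}"
    then obtain e where e: "\<forall>i. e i > 0" "\<forall>v\<in>A. (\<forall>i. \<bar>\<Phi> v i - \<Phi> (f y) i\<bar> < e i) \<longrightarrow> v \<in> W"
      using W unfolding openin_box_topology by blast
    obtain N where N: "openin Y N" "y \<in> N" "\<forall>y'\<in>N. \<forall>i. \<bar>\<Phi> (f y') i - \<Phi> (f y) i\<bar> < e i"
      using assms(2)[of y e] y e(1) by auto
    then have "N \<subseteq> {y \<in> topspace Y. f y \<in> W}"
      using e(2) assms(1) openin_subset[OF N(1)] by blast
    with N show "\<exists>T. openin Y T \<and> y \<in> T \<and> T \<subseteq> {y \<in> topspace Y. f y \<in> W}"
      by blast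
  qed
qed (use assms(1) in auto)

section \<open>The free group topology as a supremum and its universal property\<close>

definition admissible_topology :: "'a topology \<Rightarrow> ('a \<times> bool) list topology \<Rightarrow> bool" where
  "admissible_topology X T \<longleftrightarrow> free_group_topology X T \<and> continuous_map X T word_of"

lemma FTG_eq: "FTG X = topology_generated_by (\<Union>{Collect (openin T) | T. admissible_topology X T})"
  unfolding FTG_def admissible_topology_def ..

lemma openin_FTG: "admissible_topology X T \<Longrightarrow> openin T W \<Longrightarrow> openin (FTG X) W"
  unfolding FTG_eq by (rule topology_generated_by_Basis) blast

lemma topspace_admissible: "admissible_topology X T \<Longrightarrow> topspace T = free_words (topspace X)"
  unfolding admissible_topology_def free_group_topology_def by blast

text \<open>A constant \<open>\<Phi>\<close> induces the indiscrete topology. Its role is to show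
  that the supremum runs over a nonempty family, which fixes the carrier of
  \<open>FTG X\<close>.\<close>

lemma admissible_topology_coarsest:
  "admissible_topology X (box_topology (free_words (topspace X)) (\<lambda>w (i::unit). 0))"
  unfolding admissible_topology_def free_group_topology_def
  by (auto intro!: continuous_map_box_topology word_mult_in_free_words word_inv_in_free_words
       intro: openin_topspace simp: word_of_def)

lemma topspace_FTG [simp]: "topspace (FTG X) = free_words (topspace X)"
proof
  show "topspace (FTG X) \<subseteq> free_words (topspace X)"
    unfolding FTG_eq topology_generated_by_topspace
    using topspace_admissible openin_subset by fastforce
  show "free_words (topspace X) \<subseteq> topspace (FTG X)"
    using openin_FTG[OF admissible_topology_coarsest openin_topspace]
    by (auto dest: openin_subset)
qed

text \<open>The open sets of the admissible topologies form a subbase, so preimages need to be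
  checked only for one such topology at a time.\<close>

lemma continuous_map_FTG:
  assumes "f ` topspace Y \<subseteq> free_words (topspace X)"
    and "\<And>T. admissible_topology X T \<Longrightarrow> continuous_map Y T f"
  shows "continuous_map Y (FTG X) f"
proof -
  have 1: "openin Y (f -` U \<inter> topspace Y)" if "admissible_topology X T" "openin T U" for T U
    using openin_continuous_map_preimage[OF assms(2)[OF that(1)] that(2)]
    by (simp add: vimage_def Collect_conj_eq Int_commute)
  have "f ` topspace Y \<subseteq> topspace (FTG X)"
    using assms(1) by simp
  then show ?thesis
    unfolding FTG_eq topology_generated_by_topspace continuous_on_generated_topo_iff using 1 by blast
qed

lemma continuous_map_id_FTG:
  assumes "admissible_topology X T"
  shows "continuous_map (FTG X) T id"
  unfolding continuous_map_def
proof (intro conjI allI impI)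
  fix U assume U: "openin T U"
  then have "{x \<in> topspace (FTG X). id x \<in> U} = U"
    using openin_subset[OF U] topspace_admissible[OF assms] by auto
  then show "openin (FTG X) {x \<in> topspace (FTG X). id x \<in> U}"
    using openin_FTG[OF assms U] by simp
qed (simp add: topspace_admissible[OF assms])

text \<open>A supremum of group topologies is a group topology: for each admissible \<open>T\<close>
  the product map into \<open>T\<close> factors through the continuous identity
  \<open>FTG X \<rightarrow> T\<close> on both arguments.\<close>

lemma continuous_map_word_mult:
  "continuous_map (prod_topology (FTG X) (FTG X)) (FTG X) (\<lambda>(u, v). word_mult u v)"
proof (rule continuous_map_FTG)
  fix T assume T: "admissible_topology X T"
  have "continuous_map (prod_topology (FTG X) (FTG X)) (prod_topology T T) (\<lambda>(u, v). (id u, id v))"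
    using continuous_map_id_FTG[OF T] by (simp only: continuous_map_prod_top) blast
  moreover have "continuous_map (prod_topology T T) T (\<lambda>(u, v). word_mult u v)"
    using T unfolding admissible_topology_def free_group_topology_def by blast
  ultimately have "continuous_map (prod_topology (FTG X) (FTG X)) T
     ((\<lambda>(u, v). word_mult u v) \<circ> (\<lambda>(u, v). (id u, id v)))"
    by (rule continuous_map_compose)
  then show "continuous_map (prod_topology (FTG X) (FTG X)) T (\<lambda>(u, v). word_mult u v)"
    by (simp add: comp_def case_prod_unfold)
qed (auto intro: word_mult_in_free_words)

lemma continuous_map_word_of: "continuous_map X (FTG X) word_of"
  by (rule continuous_map_FTG) (auto simp: word_of_def admissible_topology_def)

lemma continuous_map_word_inv: "continuous_map (FTG X) (FTG X) word_inv"
proof (rule continuous_map_FTG)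
  fix T assume T: "admissible_topology X T"
  then have "continuous_map T T word_inv"
    unfolding admissible_topology_def free_group_topology_def by blast
  from continuous_map_compose[OF continuous_map_id_FTG[OF T] this]
  show "continuous_map (FTG X) T word_inv" by simp
qed (auto intro: word_inv_in_free_words)

lemma continuous_map_letter: "continuous_map X (FTG X) (\<lambda>y. [(y, b)])"
proof (cases b)
  case True
  then show ?thesis using continuous_map_word_of[of X] by (simp add: word_of_def[abs_def])
next
  case False
  then show ?thesis
    using continuous_map_compose[OF continuous_map_word_of continuous_map_word_inv, of X]
    by (simp add: word_of_def comp_def)
qed

lemma continuous_map_word_mult2:
  assumes "continuous_map Y (FTG X) f" "continuous_map Y (FTG X) g"
  shows "continuous_map Y (FTG X) (\<lambda>y. word_mult (f y) (g y))"
  using continuous_map_compose[OF continuous_map_pairedI[OF assms] continuous_map_word_mult]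
  by (simp add: comp_def)

text \<open>Over a discrete space the discrete topology on the free group is itself admissible, so
  every set of words is open in the supremum.\<close>

lemma FTG_discrete_topology: "FTG (discrete_topology A) = discrete_topology (free_words A)"
proof -
  have "admissible_topology (discrete_topology A) (discrete_topology (free_words A))"
    unfolding admissible_topology_def free_group_topology_def
    by (auto simp: word_of_def word_inv_in_free_words word_mult_in_free_words
        simp flip: prod_topology_discrete_topology)
  from openin_FTG[OF this] have "openin (FTG (discrete_topology A)) W" if "W \<subseteq> free_words A" for W
    using that by simp
  then show ?thesis
    by (metis discrete_topology_unique order_refl singletonD subsetI topspace_FTG topspace_discrete_topology)
qed

section \<open>Separable spaces\<close>

text \<open>\<open>B\<close> collects the points of \<open>A\<close> with a neighbourhood free of
  their predecessors in a fixed well-order of the type. Of two distinct points one precedes the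
  other, so they cannot lie in each other's neighbourhoods.\<close>

lemma left_separated_dense:
  fixes Y :: "'b topology"
  assumes A: "A \<subseteq> topspace Y"
  obtains B U where "B \<subseteq> A" "A \<subseteq> Y closure_of B"
    "\<And>a. a \<in> B \<Longrightarrow> openin Y (U a) \<and> a \<in> U a"
    "\<And>a b. a \<in> B \<Longrightarrow> b \<in> B \<Longrightarrow> a \<in> U b \<Longrightarrow> b \<in> U a \<Longrightarrow> a = b"
proof -
  obtain r :: "'b rel" where r: "well_order_on UNIV r"
    using well_order_on by blast
  then have wf: "wf (r - Id)" and total: "total r"
    unfolding well_order_on_def linear_order_on_def by blast+
  define P where "P a V \<longleftrightarrow> openin Y V \<and> a \<in> V \<and> (\<forall>b\<in>A \<inter> V. (b, a) \<notin> r - Id)" for a V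
  define B where "B = {a\<in>A. \<exists>V. P a V}"
  define U where "U a = (SOME V. P a V)" for a
  have "P a (U a)" if "a \<in> B" for a
    using that someI_ex[of "P a"] by (simp add: B_def U_def)
  then have U: "openin Y (U a)" "a \<in> U a" "\<And>b. b \<in> A \<Longrightarrow> b \<in> U a \<Longrightarrow> (b, a) \<notin> r - Id" if "a \<in> B" for a
    using that unfolding P_def by auto
  have BA: "B \<subseteq> A" by (auto simp: B_def)
  show thesis
  proof (rule that)
    show "B \<subseteq> A" by (fact BA)
    show "A \<subseteq> Y closure_of B"
    proof
      fix a assume a: "a \<in> A"
      have "\<exists>b. b \<in> B \<and> b \<in> V" if V: "a \<in> V" "openin Y V" for V
      proof -
        \<comment> \<open>The least point of \<open>A \<inter> V\<close> belongs to
          \<open>B\<close>, with \<open>V\<close> itself as witness. This is what makes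
          \<open>B\<close> dense in \<open>A\<close>.\<close>
        obtain b where b: "b \<in> A \<inter> V" "\<And>c. (c, b) \<in> r - Id \<Longrightarrow> c \<notin> A \<inter> V"
          using wfE_min[OF wf, of a "A \<inter> V"] a V(1) by (metis IntI)
        then have "P b V" unfolding P_def using V(2) by blast
        then show ?thesis using b(1) by (auto simp: B_def)
      qed
      then show "a \<in> Y closure_of B"
        using a A unfolding in_closure_of by auto
    qed
    show "openin Y (U a) \<and> a \<in> U a" if "a \<in> B" for a using U[OF that] by simp
    show "a = b" if "a \<in> B" "b \<in> B" "a \<in> U b" "b \<in> U a" for a b
    proof (rule ccontr)
      assume "a \<noteq> b"
      then have "(a, b) \<in> r - Id \<or> (b, a) \<in> r - Id"
        using total unfolding total_on_def by auto
      then show False using U(3)[OF that(1)] U(3)[OF that(2)] that BA by auto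
    qed
  qed
qed

text \<open>The two-sided form of monotone normality: the sets \<open>strat_nbhd X S U n x\<close> with \<open>x \<in> S U n\<close>
  are neighbourhoods of \<open>x\<close> for which intersecting forces mutual membership in the given sets \<open>U\<close>.\<close>

definition strat_nbhd :: "'a topology \<Rightarrow> ('a set \<Rightarrow> nat \<Rightarrow> 'a set) \<Rightarrow> 'a set \<Rightarrow> nat \<Rightarrow> 'a \<Rightarrow> 'a set" where
  "strat_nbhd X S U n x = S U n - X closure_of S (topspace X - {x}) n"

lemma openin_topspace_minus_point: "t1_space X \<Longrightarrow> openin X (topspace X - {x})"
  by (cases "x \<in> topspace X") (simp_all add: openin_diff closedin_t1_singleton)

lemma stratificationD:
  assumes "stratification X S" "openin X U"
  shows "openin X (S U n)" "X closure_of S U n \<subseteq> U" "(\<Union>n. S U n) = U" "S U n \<subseteq> U"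
proof -
  have "openin X (S U n) \<and> X closure_of S U n \<subseteq> U" and U: "(\<Union>n. S U n) = U"
    using assms unfolding stratification_def by simp_all
  then show "openin X (S U n)" "X closure_of S U n \<subseteq> U" "(\<Union>n. S U n) = U"
    by simp_all
  show "S U n \<subseteq> U"
    using U by (metis UN_upper UNIV_I)
qed

lemma stratification_mono:
  assumes "stratification X S" "openin X U" "openin X V" "U \<subseteq> V"
  shows "S U n \<subseteq> S V n"
  using assms unfolding stratification_def by simp

lemma strat_nbhd:
  assumes "stratification X S" "t1_space X" "openin X U"
  shows "openin X (strat_nbhd X S U n x)" "x \<in> S U n \<Longrightarrow> x \<in> strat_nbhd X S U n x"
proof -
  note o = openin_topspace_minus_point[OF assms(2), of x]
  show "openin X (strat_nbhd X S U n x)"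
    unfolding strat_nbhd_def by (intro openin_diff stratificationD[OF assms(1,3)] closedin_closure_of)
  show "x \<in> strat_nbhd X S U n x" if "x \<in> S U n"
    using that stratificationD(2)[OF assms(1) o] unfolding strat_nbhd_def by blast
qed

text \<open>If \<open>y\<close> were outside \<open>U\<close>, then \<open>U\<close> would be
  contained in the complement of \<open>y\<close>, and monotonicity would put \<open>S U n\<close>
  inside the closure that \<open>strat_nbhd X S V n y\<close> removes. The common level
  \<open>n\<close> is essential for this comparison.\<close>

lemma strat_nbhd_meet:
  assumes S: "stratification X S" "t1_space X" and "openin X U" "openin X V"
    and "strat_nbhd X S U n x \<inter> strat_nbhd X S V n y \<noteq> {}"
  shows "y \<in> U"
proof (rule ccontr)
  assume "y \<notin> U"
  then have "S U n \<subseteq> S (topspace X - {y}) n"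
    using openin_subset[OF assms(3)]
    by (intro stratification_mono[OF S(1) assms(3) openin_topspace_minus_point[OF S(2)]]) auto
  also have "\<dots> \<subseteq> X closure_of S (topspace X - {y}) n"
    by (intro closure_of_subset openin_subset stratificationD[OF S(1)] openin_topspace_minus_point S)
  finally show False using assms(5) unfolding strat_nbhd_def by blast
qed

lemma ex_mem_stratification:
  assumes "stratification X S" "openin X U" "x \<in> U"
  obtains n where "x \<in> S U n"
proof -
  have "x \<in> (\<Union>n. S U n)"
    using stratificationD(3)[OF assms(1,2)] assms(3) by simp
  then show thesis using that by auto
qed

section \<open>Box neighbourhoods of reduced words\<close>

text \<open>Continuity of multiplication at \<open>([l], a)\<close> splits off one letter at a time.
  The word \<open>b\<close> is required to be reduced, so no cancellation occurs and
  \<open>b = h # c\<close> really is the product of \<open>[h]\<close> and \<open>c\<close>.\<close>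

lemma free_group_box:
  assumes "openin (FTG X) W" "a \<in> W"
  shows "\<exists>U. (\<forall>i < length a. openin X (U i) \<and> fst (a ! i) \<in> U i) \<and>
    (\<forall>b. b \<in> free_words (topspace X) \<longrightarrow> map snd b = map snd a \<longrightarrow>
       (\<forall>i < length a. fst (b ! i) \<in> U i) \<longrightarrow> b \<in> W)"
  using assms
proof (induction a arbitrary: W)
  case Nil
  then show ?case by auto
next
  case (Cons l a)
  have la: "l # a \<in> free_words (topspace X)"
    using openin_subset[OF Cons.prems(1)] Cons.prems(2) by auto
  then have lX: "fst l \<in> topspace X" and a: "a \<in> free_words (topspace X)"
    by (auto dest: free_words_ConsD)
  let ?P = "{p \<in> topspace (prod_topology (FTG X) (FTG X)). (\<lambda>(u, v). word_mult u v) p \<in> W}"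
  have "openin (prod_topology (FTG X) (FTG X)) ?P"
    by (rule openin_continuous_map_preimage[OF continuous_map_word_mult Cons.prems(1)])
  moreover have "([l], a) \<in> ?P"
    using lX a la Cons.prems(2) by (simp add: cons_red_eq_Cons free_words_def)
  ultimately obtain W1 W2 where W: "openin (FTG X) W1" "openin (FTG X) W2" "[l] \<in> W1" "a \<in> W2" "W1 \<times> W2 \<subseteq> ?P"
    unfolding openin_prod_topology_alt by meson
  define V where "V = {y \<in> topspace X. [(y, snd l)] \<in> W1}"
  have V: "openin X V" "fst l \<in> V"
    using openin_continuous_map_preimage[OF continuous_map_letter W(1)] lX W(3) by (auto simp: V_def)
  obtain U where U: "\<forall>i < length a. openin X (U i) \<and> fst (a ! i) \<in> U i"
    "\<forall>b. b \<in> free_words (topspace X) \<longrightarrow> map snd b = map snd a \<longrightarrow>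
       (\<forall>i < length a. fst (b ! i) \<in> U i) \<longrightarrow> b \<in> W2"
    using Cons.IH[OF W(2,4)] by blast
  show ?case
  proof (intro exI[of _ "\<lambda>i. case i of 0 \<Rightarrow> V | Suc j \<Rightarrow> U j"] conjI allI impI)
    fix i assume "i < length (l # a)"
    then show "openin X (case i of 0 \<Rightarrow> V | Suc j \<Rightarrow> U j)" "fst ((l # a) ! i) \<in> (case i of 0 \<Rightarrow> V | Suc j \<Rightarrow> U j)"
      using U(1) V by (cases i; simp)+
  next
    fix b assume b: "b \<in> free_words (topspace X)" "map snd b = map snd (l # a)"
      "\<forall>i<length (l # a). fst (b ! i) \<in> (case i of 0 \<Rightarrow> V | Suc j \<Rightarrow> U j)"
    obtain h c where h: "b = h # c" using b(2) by (cases b) auto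
    have "c \<in> free_words (topspace X)" using b(1) h by (auto dest: free_words_ConsD)
    moreover have "\<forall>i < length a. fst (c ! i) \<in> U i" using b(3) h by force
    ultimately have "c \<in> W2" using U(2) b(2) h by auto
    moreover have "h = (fst h, snd l)" "fst h \<in> V"
      using b(2) b(3)[rule_format, of 0] h by (auto simp: prod_eq_iff)
    then have "[h] \<in> W1" unfolding V_def by (metis (mono_tags, lifting) mem_Collect_eq)
    ultimately have "word_mult [h] c \<in> W" using W(5) by auto
    then show "b \<in> W" using b(1) h by (simp add: cons_red_eq_Cons free_words_def)
  qed
qed

text \<open>The proof gives more: every set \<open>A\<close> of words has a countable dense subset
  \<open>B\<close>. Countability of a left-separated \<open>B\<close> follows from an injective code
  with countably many values.\<close>

lemma countable_tightness_FTG_separable: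
  fixes X :: "'a topology"
  assumes "stratifiable_space X" "separable_space X"
  shows "countable_tightness (FTG X)"
  unfolding countable_tightness_def
proof (intro allI impI, elim conjE)
  fix A w assume A: "A \<subseteq> topspace (FTG X)" and w: "w \<in> FTG X closure_of A"
  obtain S where S: "stratification X S" "t1_space X"
    using assms(1) unfolding stratifiable_space_def by blast
  obtain D where D: "countable D" "D \<subseteq> topspace X" "X closure_of D = topspace X"
    using assms(2) unfolding separable_space_def by blast
  obtain B V where B: "B \<subseteq> A" "A \<subseteq> FTG X closure_of B"
    and V: "\<And>a. a \<in> B \<Longrightarrow> openin (FTG X) (V a) \<and> a \<in> V a"
    and sep: "\<And>a b. a \<in> B \<Longrightarrow> b \<in> B \<Longrightarrow> a \<in> V b \<Longrightarrow> b \<in> V a \<Longrightarrow> a = b"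
    by (rule left_separated_dense[OF A]) (rule that)
  have free: "a \<in> free_words (topspace X)" if "a \<in> B" for a
    using B(1) A that by auto
  have "\<forall>a\<in>B. \<exists>U. (\<forall>i<length a. openin X (U i) \<and> fst (a ! i) \<in> U i) \<and>
     (\<forall>b. b \<in> free_words (topspace X) \<longrightarrow> map snd b = map snd a \<longrightarrow>
       (\<forall>i<length a. fst (b ! i) \<in> U i) \<longrightarrow> b \<in> V a)"
    using V free_group_box by blast
  from bchoice[OF this] obtain U where U': "\<forall>a\<in>B. (\<forall>i<length a. openin X (U a i) \<and> fst (a ! i) \<in> U a i) \<and>
     (\<forall>b. b \<in> free_words (topspace X) \<longrightarrow> map snd b = map snd a \<longrightarrow>
       (\<forall>i<length a. fst (b ! i) \<in> U a i) \<longrightarrow> b \<in> V a)" ..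
  then have U: "openin X (U a i) \<and> fst (a ! i) \<in> U a i" if "a \<in> B" "i < length a" for a i
    using that by blast
  have box: "b \<in> V a" if "a \<in> B" "b \<in> B" "map snd b = map snd a" "\<And>i. i < length a \<Longrightarrow> fst (b ! i) \<in> U a i" for a b
    using U' free that by blast
  have "\<exists>n. fst (a ! i) \<in> S (U a i) n" if "a \<in> B" "i < length a" for a i
    using U[OF that] by (auto elim: ex_mem_stratification[OF S(1)])
  then have "\<forall>a i. \<exists>n. a \<in> B \<longrightarrow> i < length a \<longrightarrow> fst (a ! i) \<in> S (U a i) n"
    by blast
  then obtain N where N: "\<And>a i. a \<in> B \<Longrightarrow> i < length a \<Longrightarrow> fst (a ! i) \<in> S (U a i) (N a i)"
    unfolding choice_iff by blast
  define h where "h a i = strat_nbhd X S (U a i) (N a i) (fst (a ! i))" for a i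
  have "\<exists>d. d \<in> D \<and> d \<in> h a i" if "a \<in> B" "i < length a" for a i
  proof -
    have "openin X (h a i)" "fst (a ! i) \<in> h a i"
      unfolding h_def using strat_nbhd[OF S] U[OF that] N[OF that] by auto
    moreover have "fst (a ! i) \<in> X closure_of D"
      using D(3) U[OF that] openin_subset by fastforce
    ultimately show ?thesis unfolding in_closure_of by blast
  qed
  then have "\<forall>a i. \<exists>d. a \<in> B \<longrightarrow> i < length a \<longrightarrow> d \<in> D \<and> d \<in> h a i"
    by blast
  then obtain d where d: "\<And>a i. a \<in> B \<Longrightarrow> i < length a \<Longrightarrow> d a i \<in> D \<and> d a i \<in> h a i"
    unfolding choice_iff by blast
  \<comment> \<open>Equal codes mean equal signs, equal levels \<open>N\<close>, and a common point
    of \<open>D\<close> in the neighbourhoods of corresponding letters. By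
    \<open>strat_nbhd_meet\<close> each word then lies in the box of the other, so left-separation
    identifies them.\<close>
  define code where "code a = (map snd a, map (N a) [0..<length a], map (d a) [0..<length a])" for a
  have "inj_on code B"
  proof (rule inj_onI)
    fix a b assume ab: "a \<in> B" "b \<in> B" and eq: "code a = code b"
    from eq have snd: "map snd a = map snd b" by (simp add: code_def)
    then have len: "length a = length b" by (metis length_map)
    have "N a i = N b i \<and> d a i = d b i" if "i < length a" for i
      using eq that len by (auto simp: code_def)
    then have meet: "strat_nbhd X S (U a i) (N a i) (fst (a ! i)) \<inter> strat_nbhd X S (U b i) (N a i) (fst (b ! i)) \<noteq> {}"
      if "i < length a" for i
      using d[OF ab(1) that] d[OF ab(2), of i] that len unfolding h_def by (metis IntI empty_iff)
    show "a = b"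
    proof (rule sep[OF ab])
      show "a \<in> V b"
      proof (rule box[OF ab(2,1) snd])
        fix i assume i: "i < length b"
        show "fst (a ! i) \<in> U b i"
          by (rule strat_nbhd_meet[OF S, where V = "U a i"]) (use meet[of i] i len U ab in \<open>auto simp: Int_commute\<close>)
      qed
      show "b \<in> V a"
      proof (rule box[OF ab snd[symmetric]])
        fix i assume i: "i < length a"
        show "fst (b ! i) \<in> U a i"
          by (rule strat_nbhd_meet[OF S, where V = "U b i"]) (use meet[of i] i len U ab in auto)
      qed
    qed
  qed
  moreover have "code ` B \<subseteq> UNIV \<times> UNIV \<times> lists D"
    using d by (auto simp: code_def)
  then have "countable (code ` B)"
    by (rule countable_subset) (intro countable_SIGMA countableI_type countable_lists D(1))
  ultimately have "countable B"
    by (metis countable_image_inj_on)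
  have "FTG X closure_of A \<subseteq> FTG X closure_of B"
    using closure_of_mono[OF B(2), of "FTG X"] by simp
  then have "w \<in> FTG X closure_of B"
    using w by (rule subsetD)
  with B(1) \<open>countable B\<close> show "\<exists>B\<subseteq>A. countable B \<and> w \<in> FTG X closure_of B"
    by (intro exI[of _ B]) simp
qed

section \<open>Discrete families in non-separable spaces\<close>

text \<open>The interlacing argument known from regular Lindelof spaces: the layers
  \<open>S ?K n\<close> cover \<open>H\<close> and have closures missing \<open>K\<close>, and
  symmetrically for \<open>?H\<close>. Subtracting from each layer the closures of the opposite
  layers up to the same index makes the two unions disjoint.\<close>

lemma normal_space_stratification:
  assumes S: "stratification X S"
  shows "normal_space X"
  unfolding normal_space_def
proof (intro allI impI, elim conjE)
  fix H K assume H: "closedin X H" and K: "closedin X K" and HK: "disjnt H K"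
  let ?H = "topspace X - H" and ?K = "topspace X - K"
  have o: "openin X ?H" "openin X ?K"
    using H K by (simp_all add: closedin_def)
  define P where "P n = S ?K n - (\<Union>i\<le>n. X closure_of S ?H i)" for n
  define Q where "Q n = S ?H n - (\<Union>i\<le>n. X closure_of S ?K i)" for n
  have cl: "closedin X (\<Union>i\<le>n. X closure_of S U i)" for U n
    by (intro closedin_Union) auto
  have "openin X (P n)" "openin X (Q n)" for n
    unfolding P_def Q_def by (intro openin_diff stratificationD(1)[OF S] o cl)+
  then have "openin X (\<Union>n. P n)" "openin X (\<Union>n. Q n)"
    by blast+
  moreover have "H \<subseteq> (\<Union>n. P n)"
  proof
    fix x assume x: "x \<in> H"
    then have "x \<in> ?K" using HK closedin_subset[OF H] by (auto simp: disjnt_iff)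
    then obtain n where "x \<in> S ?K n" by (rule ex_mem_stratification[OF S o(2)])
    moreover have "x \<notin> X closure_of S ?H i" for i
      using stratificationD(2)[OF S o(1), of i] x by auto
    ultimately show "x \<in> (\<Union>n. P n)" unfolding P_def by auto
  qed
  moreover have "K \<subseteq> (\<Union>n. Q n)"
  proof
    fix x assume x: "x \<in> K"
    then have "x \<in> ?H" using HK closedin_subset[OF K] by (auto simp: disjnt_iff)
    then obtain n where "x \<in> S ?H n" by (rule ex_mem_stratification[OF S o(1)])
    moreover have "x \<notin> X closure_of S ?K i" for i
      using stratificationD(2)[OF S o(2), of i] x by auto
    ultimately show "x \<in> (\<Union>n. Q n)" unfolding Q_def by auto
  qed
  moreover have "disjnt (\<Union>n. P n) (\<Union>n. Q n)"
  proof -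
    have cl: "x \<in> X closure_of S U n" if "x \<in> S U n" "openin X U" for x U n
      using that(1) closure_of_subset[OF openin_subset[OF stratificationD(1)[OF S that(2)]]] by blast
    have "x \<notin> Q m" if "x \<in> P n" for x n m
    proof
      assume "x \<in> Q m"
      with that have "x \<in> S ?K n" "x \<in> S ?H m" "\<forall>i\<le>n. x \<notin> X closure_of S ?H i" "\<forall>i\<le>m. x \<notin> X closure_of S ?K i"
        by (auto simp: P_def Q_def)
      with cl o show False by (meson nle_le)
    qed
    then show ?thesis unfolding disjnt_iff by auto
  qed
  ultimately show "\<exists>U V. openin X U \<and> openin X V \<and> H \<subseteq> U \<and> K \<subseteq> V \<and> disjnt U V"
    by (intro exI[of _ "\<Union>n. P n"] exI[of _ "\<Union>n. Q n"] conjI)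
qed

section \<open>Uncountable discrete families of open sets\<close>

lemma uncountable_Union_nat:
  assumes "uncountable E" "E \<subseteq> (\<Union>n::nat. F n)"
  obtains n where "uncountable (E \<inter> F n)"
proof -
  have "uncountable (\<Union>n. E \<inter> F n)"
    using assms by (metis Int_UN_distrib Int_absorb2)
  then have "\<exists>n. uncountable (E \<inter> F n)" by (metis countable_UN countableI_type)
  then show thesis using that by auto
qed

text \<open>A dense left-separated \<open>B\<close> must be uncountable. One pigeonhole step fixes
  the level \<open>n\<close> and yields pairwise disjoint neighbourhoods; a second one fixes a layer
  \<open>S W m\<close> of their union and upgrades disjointness to discreteness.\<close>

lemma ex_uncountable_discrete_family:
  assumes S: "stratification X S" "t1_space X" and nsep: "\<not> separable_space X"
  obtains D G where "uncountable D" "\<And>d. d \<in> D \<Longrightarrow> openin X (G d) \<and> d \<in> G d"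
    "\<And>y. y \<in> topspace X \<Longrightarrow> \<exists>N. openin X N \<and> y \<in> N \<and>
       (\<forall>d\<in>D. \<forall>d'\<in>D. N \<inter> G d \<noteq> {} \<longrightarrow> N \<inter> G d' \<noteq> {} \<longrightarrow> d = d')"
proof -
  obtain B U where B: "B \<subseteq> topspace X" "topspace X \<subseteq> X closure_of B"
    and U: "\<And>a. a \<in> B \<Longrightarrow> openin X (U a) \<and> a \<in> U a"
    and sep: "\<And>a b. a \<in> B \<Longrightarrow> b \<in> B \<Longrightarrow> a \<in> U b \<Longrightarrow> b \<in> U a \<Longrightarrow> a = b"
    by (rule left_separated_dense[OF order_refl, of X]) (rule that)
  have "X closure_of B = topspace X"
    by (intro subset_antisym closure_of_subset_topspace B)
  then have unc: "uncountable B"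
    using nsep B(1) unfolding separable_space_def by blast
  have "\<exists>n. a \<in> S (U a) n" if "a \<in> B" for a
    using U[OF that] by (auto elim: ex_mem_stratification[OF S(1)])
  then have "B \<subseteq> (\<Union>n. {a. a \<in> S (U a) n})"
    by auto
  then obtain n where n: "uncountable (B \<inter> {a. a \<in> S (U a) n})"
    by (rule uncountable_Union_nat[OF unc])
  define C where "C = B \<inter> {a. a \<in> S (U a) n}"
  define h where "h a = strat_nbhd X S (U a) n a" for a
  have h: "openin X (h a)" "a \<in> h a" if "a \<in> C" for a
    unfolding h_def using strat_nbhd[OF S] U[of a] that by (auto simp: C_def)
  have disj: "a = b" if "a \<in> C" "b \<in> C" "h a \<inter> h b \<noteq> {}" for a b
  proof (rule sep)
    show "b \<in> U a"
      by (rule strat_nbhd_meet[OF S, where V = "U b"]) (use that U h_def in \<open>auto simp: C_def\<close>)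
    show "a \<in> U b"
      by (rule strat_nbhd_meet[OF S, where V = "U a"]) (use that U h_def in \<open>auto simp: C_def Int_commute\<close>)
  qed (use that in \<open>auto simp: C_def\<close>)
  \<comment> \<open>The sets \<open>h a\<close> may still accumulate at points outside
    \<open>W\<close>. Cutting them down to \<open>S W m\<close>, whose closure stays inside
    \<open>W\<close>, gives every such point a neighbourhood that meets none of them.\<close>
  define W where "W = (\<Union>a\<in>C. h a)"
  have W: "openin X W" unfolding W_def using h(1) by blast
  have "C \<subseteq> (\<Union>m. S W m)"
    unfolding stratificationD(3)[OF S(1) W] using h(2) by (auto simp: W_def)
  then obtain m where m: "uncountable (C \<inter> S W m)"
    using uncountable_Union_nat n unfolding C_def by blast
  show thesis
  proof (rule that[OF m, of "\<lambda>d. h d \<inter> S W m"])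
    show "openin X (h d \<inter> S W m) \<and> d \<in> h d \<inter> S W m" if "d \<in> C \<inter> S W m" for d
      using h that stratificationD(1)[OF S(1) W] by (auto intro: openin_Int)
    fix y assume y: "y \<in> topspace X"
    show "\<exists>N. openin X N \<and> y \<in> N \<and> (\<forall>d\<in>C \<inter> S W m. \<forall>d'\<in>C \<inter> S W m.
       N \<inter> (h d \<inter> S W m) \<noteq> {} \<longrightarrow> N \<inter> (h d' \<inter> S W m) \<noteq> {} \<longrightarrow> d = d')"
    proof (cases "y \<in> W")
      case True
      then obtain a where a: "a \<in> C" "y \<in> h a" by (auto simp: W_def)
      have "d = a" if "d \<in> C \<inter> S W m" "h a \<inter> (h d \<inter> S W m) \<noteq> {}" for d
        using disj[OF _ a(1), of d] that by blast
      then show ?thesis using h(1)[OF a(1)] a(2)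
        by (intro exI[of _ "h a"]) blast
    next
      case False
      have "S W m \<subseteq> X closure_of S W m"
        by (intro closure_of_subset openin_subset stratificationD[OF S(1) W])
      moreover have "y \<notin> X closure_of S W m"
        using stratificationD(2)[OF S(1) W, of m] False by blast
      ultimately show ?thesis
        using y by (intro exI[of _ "topspace X - X closure_of S W m"]) auto
    qed
  qed
qed

section \<open>Convergent sequences in k-spaces\<close>

text \<open>A non-closed set is detected on some compact \<open>K\<close>, which provides a limit
  point \<open>x\<close> of \<open>K \<inter> A\<close> outside \<open>A\<close>. The stratification
  makes \<open>x\<close> a G-delta point through the sets \<open>V n\<close>, and inside
  \<open>K\<close> compactness turns any choice of points from these sets into a convergent
  sequence.\<close>

lemma ex_nontrivial_sequence:
  assumes S: "stratification X S" "t1_space X" and k: "k_space X"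
    and ndisc: "X \<noteq> discrete_topology (topspace X)"
  obtains x and xs :: "nat \<Rightarrow> 'a" where "x \<in> topspace X" "range xs \<subseteq> topspace X - {x}" "limitin X xs x sequentially"
proof -
  have "\<exists>A. A \<subseteq> topspace X \<and> \<not> closedin X A"
  proof (rule ccontr)
    assume *: "\<not> (\<exists>A. A \<subseteq> topspace X \<and> \<not> closedin X A)"
    have "openin X {x}" if "x \<in> topspace X" for x
    proof -
      have "closedin X (topspace X - {x})" using * by auto
      then show ?thesis using that by (simp add: closedin_def Diff_Diff_Int)
    qed
    then show False using ndisc discrete_topology_unique[of "topspace X" X] by metis
  qed
  then obtain A where A: "A \<subseteq> topspace X" "\<not> closedin X A" by blast
  then obtain K where K: "compactin X K" "\<not> closedin (subtopology X K) (K \<inter> A)"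
    using k unfolding k_space_def by blast
  then have KX: "K \<subseteq> topspace X" by (simp add: compactin_subset_topspace)
  have "\<not> (subtopology X K) closure_of (K \<inter> A) \<subseteq> K \<inter> A"
    using K(2) KX by (metis closure_of_subset_eq Int_lower1 topspace_subtopology_subset)
  then obtain x where x: "x \<in> K" "x \<notin> A" "x \<in> X closure_of (K \<inter> A)"
    by (auto simp: closure_of_subtopology)
  let ?U = "topspace X - {x}"
  have oU: "openin X ?U" by (rule openin_topspace_minus_point[OF S(2)])
  define V where "V n = topspace X - (\<Union>i\<le>n. X closure_of S ?U i)" for n
  have V: "openin X (V n)" "x \<in> V n" for n
  proof -
    show "openin X (V n)" unfolding V_def by (intro openin_diff closedin_Union) auto
    show "x \<in> V n" unfolding V_def using x(1) KX stratificationD(2)[OF S(1) oU] by blast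
  qed
  have "\<exists>y. y \<in> K \<inter> A \<and> y \<in> V n" for n
    using x(3) V[of n] unfolding in_closure_of by blast
  then obtain xs where xs: "\<And>n. xs n \<in> K \<inter> A \<and> xs n \<in> V n" by metis
  have nS: "xs n \<notin> S ?U i" if "i \<le> n" for n i
  proof -
    have "S ?U i \<subseteq> X closure_of S ?U i"
      by (intro closure_of_subset openin_subset stratificationD[OF S(1) oU])
    then show ?thesis using xs[of n] that unfolding V_def by blast
  qed
  have "limitin X xs x sequentially"
    unfolding limitin_def
  proof (intro conjI allI impI)
    show "x \<in> topspace X" using x(1) KX by blast
    fix W assume "openin X W \<and> x \<in> W"
    then have W: "openin X W" "x \<in> W" by simp_all
    \<comment> \<open>Together with \<open>W\<close> the layers \<open>S ?U i\<close> cover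
      \<open>K\<close>, and \<open>xs n\<close> avoids all layers of index at most \<open>n\<close>.
      Once \<open>n\<close> exceeds the indices in a finite subcover, only \<open>W\<close> is left
      to contain \<open>xs n\<close>.\<close>
    have "K \<subseteq> \<Union>(insert W (range (S ?U)))"
      using KX W(2) stratificationD(3)[OF S(1) oU] by auto
    moreover have "\<And>B. B \<in> insert W (range (S ?U)) \<Longrightarrow> openin X B"
      using W(1) stratificationD(1)[OF S(1) oU] by blast
    ultimately obtain \<F> where F: "finite \<F>" "\<F> \<subseteq> insert W (range (S ?U))" "K \<subseteq> \<Union>\<F>"
      using K(1) unfolding compactin_def by meson
    have "\<F> - {W} \<subseteq> S ?U ` UNIV" using F(2) by auto
    then obtain I where I: "finite I" "\<F> - {W} = S ?U ` I"
      using F(1) by (meson finite_Diff finite_subset_image)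
    \<comment> \<open>Inserting 0 keeps the maximum meaningful when \<open>W\<close> alone covers
      \<open>K\<close> and \<open>I\<close> is empty.\<close>
    have "xs n \<in> W" if "n \<ge> Max (insert 0 I)" for n
    proof -
      have "xs n \<notin> S ?U i" if "i \<in> I" for i
        using I(1) that \<open>n \<ge> _\<close> by (intro nS) simp
      then show ?thesis using F(3) xs[of n] I(2) by blast
    qed
    then show "\<forall>\<^sub>F n in sequentially. xs n \<in> W"
      unfolding eventually_sequentially by (intro exI allI impI)
  qed
  moreover have "range xs \<subseteq> topspace X - {x}" using xs KX x(2) by auto
  ultimately show thesis using x(1) KX that by blast
qed

section \<open>Uncountable sets with countable initial segments\<close>

text \<open>Cut \<open>D\<close> at the least point with uncountably many predecessors in
  \<open>D\<close>, if there is one; otherwise keep all of \<open>D\<close>. Either way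
  \<open>E\<close> has order type omega_1 under \<open>r\<close>.\<close>

lemma ex_uncountable_countable_segments:
  assumes "uncountable D"
  obtains E and r :: "'a rel" where "E \<subseteq> D" "uncountable E" "total r" "refl r"
    "\<And>a. a \<in> E \<Longrightarrow> countable {b\<in>E. (b, a) \<in> r}"
proof -
  obtain r :: "'a rel" where r: "well_order_on UNIV r"
    using well_order_on by blast
  then have wf: "wf (r - Id)" and lin: "total r" "refl r"
    unfolding well_order_on_def linear_order_on_def partial_order_on_def preorder_on_def by auto
  show thesis
  proof (cases "\<exists>a. uncountable {b\<in>D. (b, a) \<in> r - Id}")
    case False
    have "countable {b\<in>D. (b, a) \<in> r}" for a
    proof (rule countable_subset)
      show "{b\<in>D. (b, a) \<in> r} \<subseteq> insert a {b\<in>D. (b, a) \<in> r - Id}" by auto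
      show "countable (insert a {b\<in>D. (b, a) \<in> r - Id})" using False by simp
    qed
    then show ?thesis using that[of D r] assms lin by simp
  next
    case True
    let ?Z = "{a. uncountable {b\<in>D. (b, a) \<in> r - Id}}"
    from True obtain a0 where "a0 \<in> ?Z" by blast
    with wf obtain a where "a \<in> ?Z" "\<forall>c. (c, a) \<in> r - Id \<longrightarrow> c \<notin> ?Z"
      unfolding wf_eq_minimal by meson
    then have a: "uncountable {b\<in>D. (b, a) \<in> r - Id}"
      and min: "\<And>c. (c, a) \<in> r - Id \<Longrightarrow> countable {b\<in>D. (b, c) \<in> r - Id}"
      by auto
    let ?E = "{b\<in>D. (b, a) \<in> r - Id}"
    have "countable {b\<in>?E. (b, c) \<in> r}" if "c \<in> ?E" for c
    proof (rule countable_subset)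
      show "{b\<in>?E. (b, c) \<in> r} \<subseteq> insert c {b\<in>D. (b, c) \<in> r - Id}" by auto
      show "countable (insert c {b\<in>D. (b, c) \<in> r - Id})" using min[of c] that by simp
    qed
    then show ?thesis using that[of ?E r] a lin by simp
  qed
qed

section \<open>Heisenberg representations\<close>

text \<open>The two additive coordinates of a word. There is one coordinate \<open>heis_s\<close>
  for each index \<open>d\<close>, while \<open>heis_c\<close> below is shared by all
  indices.\<close>

primrec heis_s :: "('a \<Rightarrow> 'i \<Rightarrow> real) \<Rightarrow> ('a \<times> bool) list \<Rightarrow> 'i \<Rightarrow> real" where
  "heis_s t [] d = 0"
| "heis_s t (l # w) d = (if snd l then t (fst l) d else - t (fst l) d) + heis_s t w d"

primrec heis_c :: "('a \<Rightarrow> real) \<Rightarrow> ('a \<times> bool) list \<Rightarrow> real" where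
  "heis_c r [] = 0"
| "heis_c r (l # w) = (if snd l then r (fst l) else - r (fst l)) + heis_c r w"

text \<open>Central coordinate of the homomorphism \<open>y \<mapsto> (t y, r y, 0)\<close> into the Heisenberg group with
  multiplication \<open>(s, c, z) (s', c', z') = (s + s', c + c', z + z' + c' s)\<close>.\<close>

primrec heis_z :: "('a \<Rightarrow> 'i \<Rightarrow> real) \<Rightarrow> ('a \<Rightarrow> real) \<Rightarrow> ('a \<times> bool) list \<Rightarrow> 'i \<Rightarrow> real" where
  "heis_z t r [] d = 0"
| "heis_z t r (l # w) d = (if snd l then 0 else r (fst l) * t (fst l) d) + heis_z t r w d
     + heis_c r w * (if snd l then t (fst l) d else - t (fst l) d)"

text \<open>All coordinates are packed into a single family so that one box topology covers them:
  \<open>Inl d\<close> is a noncentral coordinate, \<open>Inr None\<close> the shared one, and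
  \<open>Inr (Some d)\<close> a central one.\<close>

definition heis :: "('a \<Rightarrow> 'i \<Rightarrow> real) \<Rightarrow> ('a \<Rightarrow> real) \<Rightarrow> ('a \<times> bool) list \<Rightarrow> 'i + 'i option \<Rightarrow> real" where
  "heis t r w j = (case j of Inl d \<Rightarrow> heis_s t w d | Inr None \<Rightarrow> heis_c r w | Inr (Some d) \<Rightarrow> heis_z t r w d)"

text \<open>Cancelling a letter against its inverse changes no coordinate, because the two are sent
  to mutually inverse Heisenberg elements. Hence the coordinates define a homomorphism on reduced
  words.\<close>

lemma heis_cons_red:
  "heis_s t (cons_red l w) d = heis_s t (l # w) d"
  "heis_c r (cons_red l w) = heis_c r (l # w)"
  "heis_z t r (cons_red l w) d = heis_z t r (l # w) d"
  by (cases w; auto simp: cons_red_def algebra_simps)+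

lemma heis_word_mult:
  "heis_s t (word_mult u v) d = heis_s t u d + heis_s t v d"
  "heis_c r (word_mult u v) = heis_c r u + heis_c r v"
  "heis_z t r (word_mult u v) d = heis_z t r u d + heis_z t r v d + heis_c r v * heis_s t u d"
  by (induction u) (simp_all add: heis_cons_red algebra_simps)

text \<open>The product formulas hold already for plain concatenation. This form is needed for
  \<open>word_inv\<close>, which is built by appending rather than by
  \<open>word_mult\<close>.\<close>

lemma heis_append:
  "heis_s t (u @ v) d = heis_s t u d + heis_s t v d"
  "heis_c r (u @ v) = heis_c r u + heis_c r v"
  "heis_z t r (u @ v) d = heis_z t r u d + heis_z t r v d + heis_c r v * heis_s t u d"
  by (induction u) (simp_all add: algebra_simps)

lemma heis_word_inv:
  "heis_s t (word_inv u) d = - heis_s t u d"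
  "heis_c r (word_inv u) = - heis_c r u"
  "heis_z t r (word_inv u) d = - heis_z t r u d + heis_c r u * heis_s t u d"
  by (induction u) (simp_all add: heis_append algebra_simps)

section \<open>Continuity of the Heisenberg operations in the box topology\<close>

lemma finite_support_heis_s:
  assumes "\<And>y. y \<in> A \<Longrightarrow> finite {d. t y d \<noteq> 0}" "w \<in> free_words A"
  shows "finite {d. heis_s t w d \<noteq> 0}"
  using assms(2)
proof (induction w)
  case (Cons l w)
  then have "fst l \<in> A" "finite {d. heis_s t w d \<noteq> 0}"
    by (auto dest: free_words_ConsD)
  moreover have "{d. heis_s t (l # w) d \<noteq> 0} \<subseteq> {d. t (fst l) d \<noteq> 0} \<union> {d. heis_s t w d \<noteq> 0}"
    by auto
  ultimately show ?case using assms(1) finite_subset by blast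
qed simp

text \<open>A single \<open>\<delta>\<close> for the scalar has to serve all coordinates at once.
  Finite support of \<open>s\<close> leaves only finitely many bounds
  \<open>\<delta> * \<bar>s d\<bar> \<le> e d / 2\<close> to satisfy.\<close>

lemma scaleR_box_continuous:
  fixes s e :: "'i \<Rightarrow> real" and c :: real
  assumes fin: "finite {d. s d \<noteq> 0}" and e: "\<And>d. e d > 0"
  obtains \<delta> \<epsilon> where "\<delta> > 0" "\<And>d. \<epsilon> d > 0"
    "\<And>c' s' d. \<bar>c' - c\<bar> < \<delta> \<Longrightarrow> \<bar>s' - s d\<bar> < \<epsilon> d \<Longrightarrow> \<bar>c' * s' - c * s d\<bar> < e d"
proof -
  \<comment> \<open>The entry 1 covers the case of empty support and also gives
    \<open>\<bar>c'\<bar> \<le> 1 + \<bar>c\<bar>\<close>, from which the radii for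
    \<open>s'\<close> are computed.\<close>
  define \<delta> where "\<delta> = Min (insert 1 ((\<lambda>d. e d / (2 * \<bar>s d\<bar>)) ` {d. s d \<noteq> 0}))"
  have pos: "\<delta> > 0" and le1: "\<delta> \<le> 1" using fin e by (auto simp: \<delta>_def)
  have small: "\<delta> * \<bar>s d\<bar> \<le> e d / 2" for d
  proof (cases "s d = 0")
    case False
    then have "\<delta> \<le> e d / (2 * \<bar>s d\<bar>)" using fin unfolding \<delta>_def by (intro Min_le) auto
    then show ?thesis using False by (simp add: field_simps)
  qed (use e[of d] in simp)
  show thesis
  proof (rule that[OF pos, of "\<lambda>d. e d / (2 * (1 + \<bar>c\<bar>))"])
    show "e d / (2 * (1 + \<bar>c\<bar>)) > 0" for d
      using e[of d] by (intro divide_pos_pos) auto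
    fix c' s' d assume c': "\<bar>c' - c\<bar> < \<delta>" and s': "\<bar>s' - s d\<bar> < e d / (2 * (1 + \<bar>c\<bar>))"
    have "\<bar>c' * s' - c * s d\<bar> = \<bar>(c' - c) * s d + c' * (s' - s d)\<bar>"
      by (simp add: algebra_simps)
    also have "\<dots> \<le> \<bar>c' - c\<bar> * \<bar>s d\<bar> + \<bar>c'\<bar> * \<bar>s' - s d\<bar>"
      by (metis abs_mult abs_triangle_ineq)
    also have "\<dots> \<le> \<delta> * \<bar>s d\<bar> + (1 + \<bar>c\<bar>) * \<bar>s' - s d\<bar>"
      using c' le1 by (intro add_mono mult_right_mono) auto
    also have "\<dots> < e d / 2 + e d / 2"
    proof (intro add_le_less_mono small)
      have "(1 + \<bar>c\<bar>) * \<bar>s' - s d\<bar> < (1 + \<bar>c\<bar>) * (e d / (2 * (1 + \<bar>c\<bar>)))"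
        using s' by (intro mult_strict_left_mono) auto
      also have "\<dots> = e d / 2" by (simp add: field_simps)
      finally show "(1 + \<bar>c\<bar>) * \<bar>s' - s d\<bar> < e d / 2" .
    qed
    finally show "\<bar>c' * s' - c * s d\<bar> < e d" by simp
  qed
qed

lemma all_heis_index:
  "(\<forall>j. P j) \<longleftrightarrow> (\<forall>d. P (Inl d)) \<and> P (Inr None) \<and> (\<forall>d. P (Inr (Some d)))"
  by (metis option.exhaust sum.exhaust)

lemma heis_simps [simp]:
  "heis t r w (Inl d) = heis_s t w d" "heis t r w (Inr None) = heis_c r w"
  "heis t r w (Inr (Some d)) = heis_z t r w d"
  by (simp_all add: heis_def)

lemma continuous_map_heis_word_mult:
  fixes t :: "'a \<Rightarrow> 'b \<Rightarrow> real" and r :: "'a \<Rightarrow> real"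
  assumes fin: "\<And>y. y \<in> A \<Longrightarrow> finite {d. t y d \<noteq> 0}"
  defines "T \<equiv> box_topology (free_words A) (heis t r)"
  shows "continuous_map (prod_topology T T) T (\<lambda>(u, v). word_mult u v)"
  unfolding T_def
proof (rule continuous_map_box_topology, fold T_def)
  have top: "topspace T = free_words A" by (simp add: T_def)
  fix p assume "p \<in> topspace (prod_topology T T)"
  then obtain u v where p: "p = (u, v)" "u \<in> free_words A" "v \<in> free_words A"
    by (auto simp: top)
  show "(case p of (u, v) \<Rightarrow> word_mult u v) \<in> free_words A"
    using p by (simp add: word_mult_in_free_words)
  fix e :: "'b + 'b option \<Rightarrow> real" assume e: "\<And>i. e i > 0"
  have fu: "finite {d. heis_s t u d \<noteq> 0}"
    by (rule finite_support_heis_s[where A = A]) (use fin p(2) in auto)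
  have e3: "e (Inr (Some d)) / 3 > 0" for d using e by simp
  obtain \<delta> \<epsilon> where \<delta>: "\<delta> > 0" "\<And>d. \<epsilon> d > 0"
    and close: "\<And>c' s' d. \<bar>c' - heis_c r v\<bar> < \<delta> \<Longrightarrow> \<bar>s' - heis_s t u d\<bar> < \<epsilon> d \<Longrightarrow>
        \<bar>c' * s' - heis_c r v * heis_s t u d\<bar> < e (Inr (Some d)) / 3"
    by (rule scaleR_box_continuous[OF fu e3, of "heis_c r v"]) (rule that)
  \<comment> \<open>The central coordinate of a product has three summands, hence the thirds. The
    mixed term \<open>heis_c r v * heis_s t u d\<close> asks for \<open>\<epsilon>\<close> on the
    left factor and \<open>\<delta>\<close> on the right one.\<close>
  define e1 where "e1 j = (case j of Inl d \<Rightarrow> min (e j / 2) (\<epsilon> d) | Inr None \<Rightarrow> e j / 2 | Inr (Some d) \<Rightarrow> e j / 3)" for j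
  define e2 where "e2 j = (case j of Inl d \<Rightarrow> e j / 2 | Inr None \<Rightarrow> min (e j / 2) \<delta> | Inr (Some d) \<Rightarrow> e j / 3)" for j
  have e12: "e1 j > 0" "e2 j > 0" for j
    using e \<delta> by (auto simp: e1_def e2_def split: sum.splits option.splits)
  let ?N1 = "{w \<in> free_words A. \<forall>j. \<bar>heis t r w j - heis t r u j\<bar> < e1 j}"
  let ?N2 = "{w \<in> free_words A. \<forall>j. \<bar>heis t r w j - heis t r v j\<bar> < e2 j}"
  show "\<exists>N. openin (prod_topology T T) N \<and> p \<in> N \<and>
     (\<forall>y'\<in>N. \<forall>i. \<bar>heis t r (case y' of (u, v) \<Rightarrow> word_mult u v) i
        - heis t r (case p of (u, v) \<Rightarrow> word_mult u v) i\<bar> < e i)"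
  proof (intro exI[of _ "?N1 \<times> ?N2"] conjI ballI)
    show "openin (prod_topology T T) (?N1 \<times> ?N2)"
      unfolding openin_prod_Times_iff T_def by (intro disjI2 conjI openin_box_topology_box e12)
    show "p \<in> ?N1 \<times> ?N2" using p e12 by simp
    fix q assume "q \<in> ?N1 \<times> ?N2"
    then obtain u' v' where q: "q = (u', v')" "\<forall>j. \<bar>heis t r u' j - heis t r u j\<bar> < e1 j"
      "\<forall>j. \<bar>heis t r v' j - heis t r v j\<bar> < e2 j" by auto
    have 1: "\<bar>heis_s t u' d - heis_s t u d\<bar> < e (Inl d) / 2" "\<bar>heis_s t u' d - heis_s t u d\<bar> < \<epsilon> d"
      "\<bar>heis_c r u' - heis_c r u\<bar> < e (Inr None) / 2" "\<bar>heis_z t r u' d - heis_z t r u d\<bar> < e (Inr (Some d)) / 3" for d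
      using q(2) by (simp_all add: all_heis_index e1_def)
    have 2: "\<bar>heis_s t v' d - heis_s t v d\<bar> < e (Inl d) / 2" "\<bar>heis_c r v' - heis_c r v\<bar> < \<delta>"
      "\<bar>heis_c r v' - heis_c r v\<bar> < e (Inr None) / 2" "\<bar>heis_z t r v' d - heis_z t r v d\<bar> < e (Inr (Some d)) / 3" for d
      using q(3) by (simp_all add: all_heis_index e2_def)
    have zc: "\<bar>heis_c r v' * heis_s t u' d - heis_c r v * heis_s t u d\<bar> < e (Inr (Some d)) / 3" for d
      by (rule close) (use 1 2 in auto)
    have z: "\<bar>heis_z t r (word_mult u' v') d - heis_z t r (word_mult u v) d\<bar> < e (Inr (Some d))" for d
      using 1(4)[of d] 2(4)[of d] zc[of d] unfolding heis_word_mult by linarith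
    have s: "\<bar>heis_s t (word_mult u' v') d - heis_s t (word_mult u v) d\<bar> < e (Inl d)" for d
      using 1(1)[of d] 2(1)[of d] unfolding heis_word_mult by linarith
    have c: "\<bar>heis_c r (word_mult u' v') - heis_c r (word_mult u v)\<bar> < e (Inr None)"
      using 1(3) 2(3) unfolding heis_word_mult by linarith
    show "\<forall>i. \<bar>heis t r (case q of (u, v) \<Rightarrow> word_mult u v) i
        - heis t r (case p of (u, v) \<Rightarrow> word_mult u v) i\<bar> < e i"
      unfolding p(1) q(1) all_heis_index using s c z by simp
  qed
qed

lemma continuous_map_heis_word_inv:
  fixes t :: "'a \<Rightarrow> 'b \<Rightarrow> real" and r :: "'a \<Rightarrow> real"
  assumes fin: "\<And>y. y \<in> A \<Longrightarrow> finite {d. t y d \<noteq> 0}"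
  defines "T \<equiv> box_topology (free_words A) (heis t r)"
  shows "continuous_map T T word_inv"
  unfolding T_def
proof (rule continuous_map_box_topology, fold T_def)
  fix u assume "u \<in> topspace T"
  then have u: "u \<in> free_words A" by (simp add: T_def)
  show "word_inv u \<in> free_words A"
    using u by (rule word_inv_in_free_words)
  fix e :: "'b + 'b option \<Rightarrow> real" assume e: "\<And>i. e i > 0"
  have fu: "finite {d. heis_s t u d \<noteq> 0}"
    by (rule finite_support_heis_s[where A = A]) (use fin u in auto)
  have e2: "e (Inr (Some d)) / 2 > 0" for d using e by simp
  obtain \<delta> \<epsilon> where \<delta>: "\<delta> > 0" "\<And>d. \<epsilon> d > 0"
    and close: "\<And>c' s' d. \<bar>c' - heis_c r u\<bar> < \<delta> \<Longrightarrow> \<bar>s' - heis_s t u d\<bar> < \<epsilon> d \<Longrightarrow>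
        \<bar>c' * s' - heis_c r u * heis_s t u d\<bar> < e (Inr (Some d)) / 2"
    by (rule scaleR_box_continuous[OF fu e2, of "heis_c r u"]) (rule that)
  \<comment> \<open>Inversion has only two central summands, and its mixed term involves the same
    word twice, so \<open>\<epsilon>\<close> and \<open>\<delta>\<close> restrict one
    neighbourhood.\<close>
  define e1 where "e1 j = (case j of Inl d \<Rightarrow> min (e j) (\<epsilon> d) | Inr None \<Rightarrow> min (e j) \<delta> | Inr (Some d) \<Rightarrow> e j / 2)" for j
  have e1: "e1 j > 0" for j
    using e \<delta> by (auto simp: e1_def split: sum.splits option.splits)
  let ?N = "{w \<in> free_words A. \<forall>j. \<bar>heis t r w j - heis t r u j\<bar> < e1 j}"
  show "\<exists>N. openin T N \<and> u \<in> N \<and> (\<forall>y'\<in>N. \<forall>i. \<bar>heis t r (word_inv y') i - heis t r (word_inv u) i\<bar> < e i)"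
  proof (intro exI[of _ ?N] conjI ballI)
    show "openin T ?N"
      unfolding T_def by (rule openin_box_topology_box[OF e1])
    show "u \<in> ?N" using u e1 by simp
    fix u' assume "u' \<in> ?N"
    then have q: "\<forall>j. \<bar>heis t r u' j - heis t r u j\<bar> < e1 j" by auto
    have 1: "\<bar>heis_s t u' d - heis_s t u d\<bar> < e (Inl d)" "\<bar>heis_s t u' d - heis_s t u d\<bar> < \<epsilon> d"
      "\<bar>heis_c r u' - heis_c r u\<bar> < \<delta>" "\<bar>heis_c r u' - heis_c r u\<bar> < e (Inr None)"
      "\<bar>heis_z t r u' d - heis_z t r u d\<bar> < e (Inr (Some d)) / 2" for d
      using q by (simp_all add: all_heis_index e1_def)
    have zc: "\<bar>heis_c r u' * heis_s t u' d - heis_c r u * heis_s t u d\<bar> < e (Inr (Some d)) / 2" for d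
      by (rule close) (use 1 in auto)
    have z: "\<bar>heis_z t r (word_inv u') d - heis_z t r (word_inv u) d\<bar> < e (Inr (Some d))" for d
      using 1(5)[of d] zc[of d] unfolding heis_word_inv by linarith
    have s: "\<bar>heis_s t (word_inv u') d - heis_s t (word_inv u) d\<bar> < e (Inl d)" for d
      using 1(1)[of d] unfolding heis_word_inv by linarith
    have c: "\<bar>heis_c r (word_inv u') - heis_c r (word_inv u)\<bar> < e (Inr None)"
      using 1(4) unfolding heis_word_inv by linarith
    show "\<forall>i. \<bar>heis t r (word_inv u') i - heis t r (word_inv u) i\<bar> < e i"
      unfolding all_heis_index using s c z by simp
  qed
qed

text \<open>Near any point at most one function \<open>t _ d0\<close> is nonzero. So words have
  finitely supported noncentral coordinates, and on generators the infinitely many box conditions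
  reduce to those on \<open>t _ d0\<close> and \<open>r\<close>.\<close>

lemma admissible_heis_topology:
  fixes t :: "'a \<Rightarrow> 'b \<Rightarrow> real" and r :: "'a \<Rightarrow> real"
  assumes t: "\<And>d. continuous_map X euclideanreal (\<lambda>y. t y d)" and r: "continuous_map X euclideanreal r"
    and loc: "\<And>y. y \<in> topspace X \<Longrightarrow> \<exists>N d0. openin X N \<and> y \<in> N \<and> (\<forall>y'\<in>N. \<forall>d. d \<noteq> d0 \<longrightarrow> t y' d = 0)"
  shows "admissible_topology X (box_topology (free_words (topspace X)) (heis t r))"
proof -
  have fin: "finite {d. t y d \<noteq> 0}" if y: "y \<in> topspace X" for y
  proof -
    obtain N d0 where "y \<in> N" "\<forall>y'\<in>N. \<forall>d. d \<noteq> d0 \<longrightarrow> t y' d = 0"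
      using loc[OF y] by blast
    then have "{d. t y d \<noteq> 0} \<subseteq> {d0}" by auto
    then show ?thesis using finite_subset by blast
  qed
  have "continuous_map X (box_topology (free_words (topspace X)) (heis t r)) word_of"
  proof (rule continuous_map_box_topology)
    fix y and e :: "'b + 'b option \<Rightarrow> real" assume y: "y \<in> topspace X" and e: "\<And>i. e i > 0"
    obtain N d0 where N: "openin X N" "y \<in> N" and 0: "\<And>y' d. y' \<in> N \<Longrightarrow> d \<noteq> d0 \<Longrightarrow> t y' d = 0"
      using loc[OF y] by blast
    let ?Nt = "{y' \<in> topspace X. t y' d0 \<in> ball (t y d0) (e (Inl d0))}"
    let ?Nr = "{y' \<in> topspace X. r y' \<in> ball (r y) (e (Inr None))}"
    have "openin X ?Nt" "openin X ?Nr"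
      using openin_continuous_map_preimage[OF t[of d0], of "ball (t y d0) (e (Inl d0))"]
        openin_continuous_map_preimage[OF r, of "ball (r y) (e (Inr None))"] by (simp_all del: mem_ball)
    then show "\<exists>N. openin X N \<and> y \<in> N \<and> (\<forall>y'\<in>N. \<forall>i. \<bar>heis t r (word_of y') i - heis t r (word_of y) i\<bar> < e i)"
    proof (intro exI[of _ "N \<inter> ?Nt \<inter> ?Nr"] conjI ballI)
      fix y' assume y': "y' \<in> N \<inter> ?Nt \<inter> ?Nr"
      have "\<bar>t y' d - t y d\<bar> < e (Inl d)" for d
        using 0[of y' d] 0[of y d] y' N(2) e[of "Inl d"] by (cases "d = d0") (auto simp: dist_real_def abs_minus_commute)
      moreover have "\<bar>r y' - r y\<bar> < e (Inr None)"
        using y' by (auto simp: dist_real_def abs_minus_commute)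
      ultimately show "\<forall>i. \<bar>heis t r (word_of y') i - heis t r (word_of y) i\<bar> < e i"
        using e unfolding all_heis_index by (simp add: word_of_def)
    qed (use N y e in auto)
  qed (simp add: word_of_def)
  then show ?thesis
    unfolding admissible_topology_def free_group_topology_def
    using continuous_map_heis_word_mult[of "topspace X" t r] continuous_map_heis_word_inv[of "topspace X" t r] fin
    by simp
qed

section \<open>The characterization\<close>

text \<open>Sum Urysohn functions separating \<open>x\<close> from each \<open>xs n\<close>, with
  weights \<open>(1/2)^n\<close>. The Weierstrass test gives continuity, and the term of index
  \<open>n\<close> alone makes the sum positive at \<open>xs n\<close>.\<close>

lemma ex_continuous_nonzero_on_sequence:
  fixes xs :: "nat \<Rightarrow> 'a"
  assumes "normal_space X" "t1_space X" and x: "x \<in> topspace X" and xs: "range xs \<subseteq> topspace X - {x}"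
  obtains r where "continuous_map X euclideanreal r" "r x = 0" "\<And>n. r (xs n) > 0"
proof -
  have "\<exists>f. continuous_map X (top_of_set {0..1::real}) f \<and> f x = 0 \<and> f (xs n) = 1" for n
  proof -
    have 1: "closedin X {x}" "closedin X {xs n}"
      using x xs assms(2) by (auto intro: closedin_t1_singleton)
    have 2: "disjnt {x} {xs n}" using xs by auto
    obtain f where "continuous_map X (top_of_set {0..1::real}) f" "f ` {x} \<subseteq> {0}" "f ` {xs n} \<subseteq> {1}"
      by (rule Urysohn_lemma[OF assms(1) 1 2 zero_le_one]) (rule that)
    then show ?thesis by auto
  qed
  then obtain f where f: "\<And>n. continuous_map X (top_of_set {0..1::real}) (f n)" "\<And>n. f n x = 0" "\<And>n. f n (xs n) = 1"
    by metis
  have cont: "continuous_map X euclideanreal (f n)" for n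
    by (rule continuous_map_into_fulltopology[OF f(1)])
  have f01: "0 \<le> f n y \<and> f n y \<le> 1" if "y \<in> topspace X" for n y
  proof -
    have "f n y \<in> {0..1}"
      using f(1)[of n] that unfolding continuous_map_in_subtopology by blast
    then show ?thesis by simp
  qed
  define r where "r y = (\<Sum>n. (1/2)^n * f n y)" for y
  have le: "norm ((1/2)^n * f n y) \<le> (1/2)^n" if "y \<in> topspace X" for n y
    using f01[OF that, of n] by (simp add: mult_left_le)
  have sm: "summable (\<lambda>n. (1/2::real)^n)" by simp
  have "uniform_limit (topspace X) (\<lambda>n y. \<Sum>i<n. (1/2)^i * f i y) r sequentially"
    unfolding r_def by (rule Weierstrass_m_test[OF le sm])
  moreover have "continuous_map X euclideanreal (\<lambda>y. \<Sum>i<n. (1/2)^i * f i y)" for n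
    using cont by (intro continuous_map_sum continuous_map_real_mult) auto
  ultimately have "continuous_map X euclideanreal r"
    using Met_TC.continuous_map_uniform_limit[where F = sequentially and X = X
        and f = "\<lambda>n y. \<Sum>i<n. (1/2)^i * f i y" and g = r]
    by (simp add: uniform_limit_iff)
  moreover have "r x = 0" by (simp add: r_def f(2))
  moreover have "r (xs n) > 0" for n
    unfolding r_def
  proof (rule suminf_pos2)
    have "xs n \<in> topspace X" using xs by auto
    then show "summable (\<lambda>i. (1/2)^i * f i (xs n))" "\<And>i. 0 \<le> (1/2)^i * f i (xs n)"
      using le f01 by (auto intro: summable_comparison_test'[OF sm])
    show "0 < (1/2)^n * f n (xs n)" by (simp add: f(3))
  qed
  ultimately show thesis using that by blast
qed

section \<open>Conjugated words converging to the identity\<close>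

text \<open>The conjugate of y x^-1 by d, built with \<open>word_mult\<close> so that it stays
  reduced when letters coincide.\<close>

definition twist :: "'a \<Rightarrow> 'a \<Rightarrow> 'a \<Rightarrow> ('a \<times> bool) list" where
  "twist d y x = word_mult [(d, True)] (word_mult [(y, True)] (word_mult [(x, False)] [(d, False)]))"

lemma twist_self: "twist d x x = []"
  by (simp add: twist_def cons_red_def)

lemma twist_in_free_words: "d \<in> A \<Longrightarrow> y \<in> A \<Longrightarrow> x \<in> A \<Longrightarrow> twist d y x \<in> free_words A"
  unfolding twist_def by (intro word_mult_in_free_words) auto

lemma length_twist: "length (twist d y x) \<le> 4"
  unfolding twist_def
  by (rule order_trans[OF length_word_mult], simp del: word_mult_Cons,
      rule order_trans[OF length_word_mult], simp del: word_mult_Cons,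
      rule order_trans[OF length_word_mult], simp)

lemma continuous_map_twist:
  assumes "d \<in> topspace X" "x \<in> topspace X"
  shows "continuous_map X (FTG X) (\<lambda>y. twist d y x)"
  unfolding twist_def using assms
  by (intro continuous_map_word_mult2 continuous_map_letter) (auto intro: continuous_map_const[THEN iffD2])

text \<open>Under these hypotheses y x^-1 is sent to (0, r y, 0), and conjugation by the image of
  \<open>d\<close> only adds the commutator \<open>r y * t d i\<close>.\<close>

lemma heis_twist:
  assumes "r x = 0" "\<And>i. t x i = 0" "\<And>i. t y i = 0"
  shows "heis_s t (twist d y x) i = 0" "heis_c r (twist d y x) = r y" "heis_z t r (twist d y x) i = r y * t d i"
  using assms by (simp_all add: twist_def heis_cons_red algebra_simps)

text \<open>For \<open>V\<close> with products of two elements inside \<open>U\<close>, each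
  \<open>d\<close> in \<open>E\<close> has its twists in \<open>V\<close> from some index on, and
  uncountably many \<open>d\<close> share one threshold \<open>M\<close>. Among these, some
  \<open>a\<close> has infinitely many predecessors; as \<open>idx a\<close> is injective, one of
  them gets an index of at least \<open>M\<close>.\<close>

lemma Nil_in_closure_of_twist_products:
  assumes E: "E \<subseteq> topspace X" "uncountable E" and R: "total R" "refl R"
    and seg: "\<And>a. a \<in> E \<Longrightarrow> countable {b\<in>E. (b, a) \<in> R}"
    and idx: "\<And>a. a \<in> E \<Longrightarrow> inj_on (idx a) {b\<in>E. (b, a) \<in> R}"
    and x: "limitin X xs x sequentially"
  shows "[] \<in> FTG X closure_of
    {word_mult (twist b (xs (idx a b)) x) (twist a (xs (idx a b)) x) | a b. a \<in> E \<and> b \<in> E \<and> (b, a) \<in> R \<and> a \<noteq> b}"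
    (is "_ \<in> _ closure_of ?A")
  unfolding in_closure_of
proof (intro conjI allI impI)
  show "[] \<in> topspace (FTG X)" by simp
  fix U assume "[] \<in> U \<and> openin (FTG X) U"
  then have U: "[] \<in> U" "openin (FTG X) U" by simp_all
  have xX: "x \<in> topspace X" using x by (rule limitin_topspace)
  let ?P = "{p \<in> topspace (prod_topology (FTG X) (FTG X)). (\<lambda>(u, v). word_mult u v) p \<in> U}"
  have "openin (prod_topology (FTG X) (FTG X)) ?P"
    by (rule openin_continuous_map_preimage[OF continuous_map_word_mult U(2)])
  moreover have "([], []) \<in> ?P" using U(1) by simp
  ultimately obtain V1 V2 where V12: "openin (FTG X) V1" "openin (FTG X) V2" "[] \<in> V1" "[] \<in> V2" "V1 \<times> V2 \<subseteq> ?P"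
    unfolding openin_prod_topology_alt by meson
  define V where "V = V1 \<inter> V2"
  have V: "openin (FTG X) V" "[] \<in> V" "\<And>u v. u \<in> V \<Longrightarrow> v \<in> V \<Longrightarrow> word_mult u v \<in> U"
    using V12 by (auto simp: V_def)
  have "\<exists>M. \<forall>n\<ge>M. twist d (xs n) x \<in> V" if "d \<in> E" for d
  proof -
    have "openin X {y \<in> topspace X. twist d y x \<in> V}"
      using that E(1) xX by (intro openin_continuous_map_preimage[OF continuous_map_twist V(1)]) auto
    moreover have "x \<in> {y \<in> topspace X. twist d y x \<in> V}"
      using xX V(2) by (simp add: twist_self)
    ultimately have "\<exists>M. \<forall>n\<ge>M. xs n \<in> {y \<in> topspace X. twist d y x \<in> V}"
      using x unfolding limitin_sequentially by meson
    then show ?thesis by auto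
  qed
  then have "E \<subseteq> (\<Union>M. {d. \<forall>n\<ge>M. twist d (xs n) x \<in> V})"
    by auto
  then obtain M where M: "uncountable (E \<inter> {d. \<forall>n\<ge>M. twist d (xs n) x \<in> V})" (is "uncountable ?E")
    by (rule uncountable_Union_nat[OF E(2)])
  then have "infinite ?E" using countable_finite by blast
  then obtain C where C: "C \<subseteq> ?E" "countable C" "infinite C"
    using infinite_countable_subset' by meson
  \<comment> \<open>Countably many countable segments cannot exhaust \<open>?E\<close>. By totality
    and reflexivity, a point outside them lies strictly above all of \<open>C\<close>.\<close>
  have "countable (\<Union>c\<in>C. {b\<in>E. (b, c) \<in> R})"
    using C seg by (intro countable_UN) auto
  then have "\<not> ?E \<subseteq> (\<Union>c\<in>C. {b\<in>E. (b, c) \<in> R})"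
    using M countable_subset by meson
  then obtain a where a: "a \<in> ?E" "\<And>c. c \<in> C \<Longrightarrow> (a, c) \<notin> R"
    by blast
  have C_a: "c \<in> E \<and> (c, a) \<in> R \<and> c \<noteq> a" if "c \<in> C" for c
  proof -
    have "c \<noteq> a" using a(2)[OF that] R(2) unfolding refl_on_def by auto
    moreover have "(c, a) \<in> R"
      using a(2)[OF that] R(1) \<open>c \<noteq> a\<close> unfolding total_on_def by blast
    ultimately show ?thesis using C(1) that by auto
  qed
  have "a \<in> E" using a(1) by simp
  have "C \<subseteq> {b\<in>E. (b, a) \<in> R}" using C_a by (intro subsetI) simp
  then have "inj_on (idx a) C"
    by (rule inj_on_subset[OF idx[OF \<open>a \<in> E\<close>]])
  then have "infinite (idx a ` C)"
    using C(3) by (metis finite_imageD)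
  then obtain c where c: "c \<in> C" "idx a c \<ge> M"
    unfolding infinite_nat_iff_unbounded_le by blast
  then have "word_mult (twist c (xs (idx a c)) x) (twist a (xs (idx a c)) x) \<in> U"
    using C(1) a(1) by (intro V(3)) auto
  moreover have "word_mult (twist c (xs (idx a c)) x) (twist a (xs (idx a c)) x) \<in> ?A"
    using C_a[OF c(1)] a(1) by blast
  ultimately show "\<exists>y. y \<in> ?A \<and> y \<in> U" by blast
qed

text \<open>Enumerating \<open>C\<close>, the threshold at an element only has to respect the finitely many pairs formed with
  earlier elements.\<close>

lemma ex_threshold_countable_pairs:
  fixes \<rho> :: "'a \<Rightarrow> 'a \<Rightarrow> real"
  assumes "countable C" "\<And>a b. \<rho> a b > 0"
  obtains \<epsilon> where "\<And>a. \<epsilon> a > 0" "\<And>a b. a \<in> C \<Longrightarrow> b \<in> C \<Longrightarrow> \<epsilon> a \<le> \<rho> a b \<or> \<epsilon> b \<le> \<rho> a b"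
proof -
  define k where "k = to_nat_on C"
  have inj: "inj_on k C" using assms(1) unfolding k_def by (rule inj_on_to_nat_on)
  define F where "F a = {c\<in>C. k c \<le> k a}" for a
  have fin: "finite (F a)" for a
  proof (rule finite_imageD)
    show "finite (k ` F a)" by (rule finite_subset[of _ "{..k a}"]) (auto simp: F_def)
    show "inj_on k (F a)" using inj by (rule inj_on_subset) (auto simp: F_def)
  qed
  \<comment> \<open>Both orders of the arguments enter, since \<open>\<rho>\<close> need not be
    symmetric and either member of a pair may be enumerated first.\<close>
  define \<epsilon> where "\<epsilon> a = Min (insert 1 ((\<lambda>c. min (\<rho> a c) (\<rho> c a)) ` F a))" for a
  have le: "\<epsilon> a \<le> \<rho> a c" "\<epsilon> a \<le> \<rho> c a" if "c \<in> F a" for a c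
  proof -
    have "\<epsilon> a \<le> min (\<rho> a c) (\<rho> c a)"
      unfolding \<epsilon>_def using fin[of a] that by (intro Min_le) auto
    then show "\<epsilon> a \<le> \<rho> a c" "\<epsilon> a \<le> \<rho> c a" by auto
  qed
  show thesis
  proof (rule that)
    show "\<epsilon> a > 0" for a
      unfolding \<epsilon>_def using fin[of a] assms(2) by simp
    show "\<epsilon> a \<le> \<rho> a b \<or> \<epsilon> b \<le> \<rho> a b" if "a \<in> C" "b \<in> C" for a b
      using le[of b a] le[of a b] that unfolding F_def by (cases "k a \<le> k b") auto
  qed
qed

section \<open>Subspaces, and failure of countable tightness in words of length at most 8\<close>

text \<open>Closure in a subspace is the trace of the closure, so the countable set found in
  \<open>Y\<close> also serves there.\<close>

lemma countable_tightness_subtopology: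
  assumes "countable_tightness Y"
  shows "countable_tightness (subtopology Y U)"
  unfolding countable_tightness_def
proof (intro allI impI, elim conjE)
  fix A x assume A: "A \<subseteq> topspace (subtopology Y U)" and x: "x \<in> subtopology Y U closure_of A"
  have AU: "U \<inter> A = A" "A \<subseteq> topspace Y" using A by auto
  have "x \<in> U" "x \<in> Y closure_of A" using x by (simp_all add: closure_of_subtopology AU)
  then obtain B where B: "B \<subseteq> A" "countable B" "x \<in> Y closure_of B"
    using assms AU(2) unfolding countable_tightness_def by meson
  moreover have "U \<inter> B = B" using B(1) AU(1) by blast
  ultimately show "\<exists>B\<subseteq>A. countable B \<and> x \<in> subtopology Y U closure_of B"
    using \<open>x \<in> U\<close> by (intro exI[of _ B]) (simp add: closure_of_subtopology)
qed

lemma not_countable_tightness_FTG_8: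
  fixes X :: "'a topology"
  assumes S: "stratification X S" "t1_space X" and k: "k_space X"
    and nsep: "\<not> separable_space X" and ndisc: "X \<noteq> discrete_topology (topspace X)"
  shows "\<not> countable_tightness (FTG_n 8 X)"
proof
  assume tight: "countable_tightness (FTG_n 8 X)"
  have normal: "normal_space X" by (rule normal_space_stratification[OF S(1)])
  obtain D G where D: "uncountable D" and G: "\<And>d. d \<in> D \<Longrightarrow> openin X (G d) \<and> d \<in> G d"
    and discr: "\<And>y. y \<in> topspace X \<Longrightarrow> \<exists>N. openin X N \<and> y \<in> N \<and>
       (\<forall>d\<in>D. \<forall>d'\<in>D. N \<inter> G d \<noteq> {} \<longrightarrow> N \<inter> G d' \<noteq> {} \<longrightarrow> d = d')"
    by (rule ex_uncountable_discrete_family[OF S nsep]) (rule that)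
  obtain x ys where x: "x \<in> topspace X" and ys: "range ys \<subseteq> topspace X - {x}" "limitin X ys x sequentially"
    by (rule ex_nontrivial_sequence[OF S k ndisc]) (rule that)
  obtain N where N: "openin X N" "x \<in> N"
    and N1: "\<And>d d'. d \<in> D \<Longrightarrow> d' \<in> D \<Longrightarrow> N \<inter> G d \<noteq> {} \<Longrightarrow> N \<inter> G d' \<noteq> {} \<Longrightarrow> d = d'"
    using discr[OF x] by meson
  obtain M where M: "\<And>n. n \<ge> M \<Longrightarrow> ys n \<in> N"
    using ys(2) N unfolding limitin_sequentially by meson
  \<comment> \<open>Dropping the first \<open>M\<close> terms places the whole sequence in
    \<open>N\<close>, where all functions \<open>t _ d\<close> are going to vanish.\<close>
  define xs where "xs n = ys (n + M)" for n
  have xs: "range xs \<subseteq> topspace X - {x}" "limitin X xs x sequentially" "\<And>n. xs n \<in> N"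
    using ys(1) limitin_sequentially_offset[OF ys(2), of M] M unfolding xs_def by auto
  obtain r where r: "continuous_map X euclideanreal r" "r x = 0" "\<And>n. r (xs n) > 0"
    by (rule ex_continuous_nonzero_on_sequence[OF normal S(2) x xs(1)]) (rule that)
  \<comment> \<open>\<open>N\<close> meets at most one \<open>G d\<close>, so at most one point of
    \<open>D\<close> is discarded.\<close>
  define D1 where "D1 = {d\<in>D. N \<inter> G d = {}}"
  have "uncountable D1"
  proof
    assume c: "countable D1"
    have "\<exists>d0. D - D1 \<subseteq> {d0}" using N1 unfolding D1_def by blast
    then have "countable (D - D1)" by (meson countable_finite finite.emptyI finite.insertI finite_subset)
    with c have "countable (D1 \<union> (D - D1))" by (rule countable_Un)
    then have "countable D" by (rule countable_subset[rotated]) blast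
    with D show False ..
  qed
  then obtain E and R :: "'a rel" where E: "E \<subseteq> D1" "uncountable E" and R: "total R" "refl R"
    and seg: "\<And>a. a \<in> E \<Longrightarrow> countable {b\<in>E. (b, a) \<in> R}"
    by (rule ex_uncountable_countable_segments) (rule that)
  have ED: "E \<subseteq> D" "\<And>d. d \<in> E \<Longrightarrow> N \<inter> G d = {}" using E(1) by (auto simp: D1_def)
  have EX: "E \<subseteq> topspace X" using G ED(1) openin_subset by blast
  have "\<exists>f. continuous_map X euclideanreal f \<and> f d = 1 \<and> (\<forall>y\<in>topspace X - G d. f y = 0)" if "d \<in> E" for d
  proof -
    have 1: "closedin X (topspace X - G d)" "closedin X {d}" "disjnt (topspace X - G d) {d}"
      using G[of d] that ED EX S(2) by (auto intro: closedin_t1_singleton)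
    obtain f where "continuous_map X euclideanreal f" "f ` (topspace X - G d) \<subseteq> {0::real}" "f ` {d} \<subseteq> {1}"
      by (rule Urysohn_lemma_alt[OF normal 1]) (rule that)
    then show ?thesis by (intro exI[of _ f]) auto
  qed
  then have "\<exists>f. \<forall>d\<in>E. continuous_map X euclideanreal (f d) \<and> f d d = 1 \<and> (\<forall>y\<in>topspace X - G d. f d y = 0)"
    by (intro bchoice) blast
  then obtain f where f: "\<And>d. d \<in> E \<Longrightarrow> continuous_map X euclideanreal (f d)" "\<And>d. d \<in> E \<Longrightarrow> f d d = (1::real)"
    "\<And>d y. d \<in> E \<Longrightarrow> y \<in> topspace X \<Longrightarrow> y \<notin> G d \<Longrightarrow> f d y = 0"
    by auto
  \<comment> \<open>Coordinates are indexed by the whole type, so \<open>t\<close> is extended by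
    zero to indices outside \<open>E\<close>.\<close>
  define t where "t y d = (if d \<in> E then f d y else 0)" for y d
  have t_out: "t y d = 0" if "y \<in> topspace X" "y \<in> G d \<Longrightarrow> d \<notin> E" for y d
    using that f(3) by (auto simp: t_def)
  have tN: "t y d = 0" if "y \<in> N" for y d
    using that ED(2) openin_subset[OF N(1)] by (intro t_out) auto
  have tE: "t a b = (if a = b then 1 else 0)" if "a \<in> E" "b \<in> E" for a b
  proof (cases "a = b")
    case False
    have aX: "a \<in> topspace X" using that EX by blast
    obtain N' where N': "a \<in> N'" "\<And>d d'. d \<in> D \<Longrightarrow> d' \<in> D \<Longrightarrow> N' \<inter> G d \<noteq> {} \<Longrightarrow> N' \<inter> G d' \<noteq> {} \<Longrightarrow> d = d'"
      using discr[OF aX] by meson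
    have "a \<notin> G b"
      using N'(2)[of a b] N'(1) G[of a] that ED(1) False by blast
    then show ?thesis using False t_out[OF aX, of b] by simp
  qed (use that f(2) in \<open>simp add: t_def\<close>)
  let ?T = "box_topology (free_words (topspace X)) (heis t r)"
  have adm: "admissible_topology X ?T"
  proof (rule admissible_heis_topology[OF _ r(1)])
    show "continuous_map X euclideanreal (\<lambda>y. t y d)" for d
      using f(1)[of d] by (cases "d \<in> E") (simp_all add: t_def)
    fix y assume y: "y \<in> topspace X"
    obtain N' where N': "openin X N'" "y \<in> N'"
      "\<And>d d'. d \<in> D \<Longrightarrow> d' \<in> D \<Longrightarrow> N' \<inter> G d \<noteq> {} \<Longrightarrow> N' \<inter> G d' \<noteq> {} \<Longrightarrow> d = d'"
      using discr[OF y] by meson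
    obtain d0 where d0: "\<And>d. d \<in> D \<Longrightarrow> N' \<inter> G d \<noteq> {} \<Longrightarrow> d = d0"
      using N'(3) by meson
    have "t y' d = 0" if "y' \<in> N'" "d \<noteq> d0" for y' d
      using d0[of d] that ED(1) openin_subset[OF N'(1)] by (intro t_out) auto
    then show "\<exists>N d0. openin X N \<and> y \<in> N \<and> (\<forall>y'\<in>N. \<forall>d. d \<noteq> d0 \<longrightarrow> t y' d = 0)"
      using N'(1,2) by (intro exI[of _ N'] exI[of _ d0]) simp
  qed
  \<comment> \<open>An injection of each countable segment into the naturals. It ties the sequence
    index of a word to its pair of points.\<close>
  define idx where "idx a = to_nat_on {b\<in>E. (b, a) \<in> R}" for a
  have idx: "inj_on (idx a) {b\<in>E. (b, a) \<in> R}" if "a \<in> E" for a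
    unfolding idx_def using seg[OF that] by (rule inj_on_to_nat_on)
  define w where "w b a = word_mult (twist b (xs (idx a b)) x) (twist a (xs (idx a b)) x)" for b a
  define A where "A = {w b a | a b. a \<in> E \<and> b \<in> E \<and> (b, a) \<in> R \<and> a \<noteq> b}"
  let ?F8 = "{v \<in> free_words (topspace X). length v \<le> 8}"
  have "w b a \<in> ?F8" if "a \<in> E" "b \<in> E" for a b
  proof -
    have "w b a \<in> free_words (topspace X)"
      unfolding w_def using that EX x xs(1) by (intro word_mult_in_free_words twist_in_free_words) auto
    moreover have "length (w b a) \<le> 4 + 4"
      unfolding w_def by (intro order_trans[OF length_word_mult] add_mono length_twist)
    ultimately show ?thesis by simp
  qed
  then have AF: "A \<subseteq> ?F8" unfolding A_def by blast
  have "[] \<in> FTG X closure_of A"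
    unfolding A_def w_def
    by (rule Nil_in_closure_of_twist_products[OF EX E(2) R seg idx xs(2)])
  moreover have "?F8 \<inter> A = A" using AF by blast
  ultimately have "[] \<in> FTG_n 8 X closure_of A"
    unfolding FTG_n_def closure_of_subtopology by simp
  moreover have "A \<subseteq> topspace (FTG_n 8 X)"
    using AF by (auto simp: FTG_n_def)
  ultimately obtain B where B: "B \<subseteq> A" "countable B" "[] \<in> FTG_n 8 X closure_of B"
    using tight unfolding countable_tightness_def by meson
  have "[] \<in> FTG X closure_of (?F8 \<inter> B)"
    using B(3) unfolding FTG_n_def closure_of_subtopology by blast
  then have BN: "[] \<in> FTG X closure_of B"
    using closure_of_mono[of "?F8 \<inter> B" B "FTG X"] by blast
  have "\<forall>v\<in>B. \<exists>p. fst p \<in> E \<and> snd p \<in> E \<and> fst p \<noteq> snd p \<and> v = w (fst p) (snd p)"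
    using B(1) unfolding A_def by fastforce
  from bchoice[OF this] obtain p where
    p: "\<And>v. v \<in> B \<Longrightarrow> fst (p v) \<in> E \<and> snd (p v) \<in> E \<and> fst (p v) \<noteq> snd (p v) \<and> v = w (fst (p v)) (snd (p v))"
    by blast
  \<comment> \<open>Only countably many points occur in the pairs that produce \<open>B\<close>, so
    thresholds can be chosen to defeat all these pairs at once.\<close>
  define C where "C = (fst \<circ> p) ` B \<union> (snd \<circ> p) ` B"
  have "countable C" using B(2) by (simp add: C_def)
  obtain \<epsilon> where \<epsilon>: "\<And>a. \<epsilon> a > 0"
    "\<And>b a. b \<in> C \<Longrightarrow> a \<in> C \<Longrightarrow> \<epsilon> b \<le> r (xs (idx a b)) \<or> \<epsilon> a \<le> r (xs (idx a b))"
    by (rule ex_threshold_countable_pairs[OF \<open>countable C\<close>, of "\<lambda>b a. r (xs (idx a b))"]) (use r(3) that in auto)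
  \<comment> \<open>The central coordinates separate the identity from \<open>B\<close>; 1 is just
    some positive radius for the others.\<close>
  define e where "e j = (case j of Inr (Some d) \<Rightarrow> \<epsilon> d | _ \<Rightarrow> 1)" for j :: "'a + 'a option"
  have e: "e j > 0" for j using \<epsilon>(1) by (auto simp: e_def split: sum.split option.split)
  let ?O = "{v \<in> free_words (topspace X). \<forall>j. \<bar>heis t r v j - heis t r [] j\<bar> < e j}"
  have O: "openin (FTG X) ?O"
    by (rule openin_FTG[OF adm openin_box_topology_box[OF e]])
  moreover have "[] \<in> ?O" using e by simp
  ultimately obtain v where v: "v \<in> B" "v \<in> ?O"
    using BN unfolding in_closure_of by meson
  obtain b a where ba: "b \<in> E" "a \<in> E" "b \<noteq> a" "v = w b a" "b \<in> C" "a \<in> C"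
    using p[OF v(1)] v(1) unfolding C_def by auto
  have z: "heis_z t r v d = r (xs (idx a b)) * (t b d + t a d)" for d
    unfolding ba(4) w_def heis_word_mult
    using r(2) tN N(2) xs(3) by (simp add: heis_twist algebra_simps)
  have "\<bar>heis_z t r v d\<bar> < \<epsilon> d" for d
    using v(2) by (simp add: all_heis_index e_def)
  \<comment> \<open>On \<open>E\<close> the values of \<open>t\<close> form an identity matrix and
    \<open>a \<noteq> b\<close>, so both central coordinates equal \<open>r (xs (idx a b))\<close>.
    It would have to lie below both thresholds.\<close>
  from this[of a] this[of b] have "r (xs (idx a b)) < \<epsilon> a" "r (xs (idx a b)) < \<epsilon> b"
    using ba(1-3) r(3)[of "idx a b"] by (simp_all add: z tE)
  then show False using \<epsilon>(2)[OF ba(5,6)] by linarith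
qed

theorem theorem3p1:
  fixes X :: "'a topology"
  assumes "stratifiable_space X" and "k_space X"
  shows "(countable_tightness (FTG_n 8 X) \<longleftrightarrow> countable_tightness (FTG X)) \<and>
         (countable_tightness (FTG X) \<longleftrightarrow>
            (separable_space X \<or> X = discrete_topology (topspace X)))"
proof -
  obtain S where S: "stratification X S" "t1_space X"
    using assms(1) unfolding stratifiable_space_def by blast
  have 21: "countable_tightness (FTG_n 8 X)" if "countable_tightness (FTG X)"
    unfolding FTG_n_def using that by (rule countable_tightness_subtopology)
  have 13: "separable_space X \<or> X = discrete_topology (topspace X)" if "countable_tightness (FTG_n 8 X)"
    using not_countable_tightness_FTG_8[OF S assms(2)] that by blast
  have "countable_tightness (FTG X)" if "X = discrete_topology (topspace X)"
  proof -
    have "FTG X = discrete_topology (free_words (topspace X))"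
      using FTG_discrete_topology[of "topspace X"] that by simp
    then have "x \<in> A" "x \<in> FTG X closure_of {x}" if "x \<in> FTG X closure_of A" for x A
      using that by (simp_all add: discrete_topology_closure_of)
    then show ?thesis
      unfolding countable_tightness_def
      by (metis countable_empty countable_insert empty_subsetI insert_subset)
  qed
  then have 32: "countable_tightness (FTG X)" if "separable_space X \<or> X = discrete_topology (topspace X)"
    using that countable_tightness_FTG_separable[OF assms(1)] by blast
  show ?thesis using 21 13 32 by blast
qed

end
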